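(* Let $N\ge 1$ and let $\ell$ be an arbitrary integer with $0\le \ell\le N-1$. If $\ell\neq \frac{N-1}{2}$, then almost every complex-valued signal $x$ with support $\{0,\dots,N-1\}$ can be uniquely recovered from $|\widehat x|$ and $|x[N-1-\ell]|$ up to rotations. If $\ell=\frac{N-1}{2}$, then almost every complex-valued signal $x$ with support $\{0,\dots,N-1\}$ can be uniquely recovered from $|\widehat x|$ and $|x[N-1-\ell]|$ up to rotations and conjugate reflections.
   Context: A (discrete-time) signal is a sequence $x=(x[n])_{n\in\mathbb Z}$ of complex numbers. It has support $\{0,\dots,N-1\}$ if $x[n]=0$ for $n\notin\{0,\dots,N-1\}$ and $x[0]\neq0$, $x[N-1]\ne 0$ (interior values may vanish). Its Fourier transform is $\widehat x(\omega)=\sum_{n\in\mathbb Z}x[n]e^{-i\omega n}$, $\omega\in\mathbb R$, and $|\widehat x|$ is the function $\omega\mapsto|\widehat x(\omega)|$ (the Fourier intensity). Signals with support $\{0,\dots,N-1\}$ are identified with vectors $(\operatorname{Re}x[0],\operatorname{Im}x[0],\dots,\operatorname{Re}x[N-1],\operatorname{Im}x[N-1])\in\mathbb R^{2N}$; "almost every" means for all outside a set of $2N$-dimensional Lebesgue measure zero. A signal $x$ with support $\{0,\dots,N-1\}$ "can be uniquely recovered from $|\widehat x|$ and $|x[m]|$ up to rotations" if every signal $y$ with support $\{0,\dots,N-1\}$ satisfying $|\widehat y|=|\widehat x|$ and $|y[m]|=|x[m]|$ is of the form $y=e^{i\alpha}x$ with $\alpha\in\mathbb R$. "Up to rotations and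 conjugate reflections" means that every such $y$ is of the form $y=e^{i\alpha}x$ or $y=e^{i\alpha}\,(\overline{x[N-1-n]})_{n\in\mathbb Z}$ with $\alpha\in\mathbb R$. *)

theory Defs
  imports "HOL-Analysis.Analysis"
begin

type_synonym signal = "int \<Rightarrow> complex"

definition has_support :: "nat \<Rightarrow> signal \<Rightarrow> bool" where
  "has_support N x \<longleftrightarrow>
     (\<forall>n. n \<notin> {0..int N - 1} \<longrightarrow> x n = 0) \<and> x 0 \<noteq> 0 \<and> x (int N - 1) \<noteq> 0"

definition fourier_transform :: "signal \<Rightarrow> real \<Rightarrow> complex" where
  "fourier_transform x \<omega> = (\<Sum>\<^sub>\<infinity>n\<in>UNIV. x n * exp (- \<i> * of_real \<omega> * of_int n))"

definition fourier_intensity :: "signal \<Rightarrow> real \<Rightarrow> real" where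
  "fourier_intensity x = (\<lambda>\<omega>. norm (fourier_transform x \<omega>))"

definition rotation :: "real \<Rightarrow> signal \<Rightarrow> signal" where
  "rotation \<alpha> x = (\<lambda>n. exp (\<i> * of_real \<alpha>) * x n)"

definition conj_reflection :: "nat \<Rightarrow> signal \<Rightarrow> signal" where
  "conj_reflection N x = (\<lambda>n. cnj (x (int N - 1 - n)))"

definition recoverable_up_to_rotations :: "nat \<Rightarrow> int \<Rightarrow> signal \<Rightarrow> bool" where
  "recoverable_up_to_rotations N m x \<longleftrightarrow>
     (\<forall>y. has_support N y \<and> fourier_intensity y = fourier_intensity x \<and> norm (y m) = norm (x m)
        \<longrightarrow> (\<exists>\<alpha>. y = rotation \<alpha> x))"

definition recoverable_up_to_rotations_and_reflections :: "nat \<Rightarrow> int \<Rightarrow> signal \<Rightarrow> bool" where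
  "recoverable_up_to_rotations_and_reflections N m x \<longleftrightarrow>
     (\<forall>y. has_support N y \<and> fourier_intensity y = fourier_intensity x \<and> norm (y m) = norm (x m)
        \<longrightarrow> (\<exists>\<alpha>. y = rotation \<alpha> x \<or> y = rotation \<alpha> (conj_reflection N x)))"

text \<open>
  The space of real \<open>d\<close>-tuples is represented by the extensional functions on \<open>{..<d}\<close>. The
  product of the Borel-Lebesgue measures has to be completed to give Lebesgue measure.
\<close>

definition lebesgue_tuples :: "nat \<Rightarrow> (nat \<Rightarrow> real) measure" where
  "lebesgue_tuples d = completion (\<Pi>\<^sub>M i\<in>{..<d}. lborel)"

text \<open>The vector \<open>(Re x[0], Im x[0], \<dots>, Re x[N-1], Im x[N-1])\<close>.\<close>

definition vector_of_signal :: "nat \<Rightarrow> signal \<Rightarrow> nat \<Rightarrow> real" where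
  "vector_of_signal N x =
     (\<lambda>i\<in>{..<2 * N}. if even i then Re (x (int (i div 2))) else Im (x (int (i div 2))))"

definition almost_every_signal :: "nat \<Rightarrow> (signal \<Rightarrow> bool) \<Rightarrow> bool" where
  "almost_every_signal N P \<longleftrightarrow>
     vector_of_signal N ` {x. has_support N x \<and> \<not> P x} \<in> null_sets (lebesgue_tuples (2 * N))"

end

theory Submission
  imports Defs "HOL-Computational_Algebra.Fundamental_Theorem_Algebra"
begin

text \<open>
  A signal supported on \<open>{0, \<dots>, d}\<close> is a complex polynomial \<open>P\<close> of
  degree \<open>d\<close> with \<open>P(0) \<noteq> 0\<close>, and its Fourier intensity is
  \<open>|P|\<close> on the unit circle. Two such polynomials with equal moduli there, here called
  cospectral, satisfy \<open>P P* = Q Q*\<close>, where \<open>P*\<close> is the conjugate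
  reversal; so \<open>Q\<close> arises from \<open>P\<close> by moving some of its roots to their
  mirror images in the circle. The claim is that for almost every \<open>P\<close> no nontrivial
  choice of roots preserves the modulus of the prescribed coefficient.

  The proof is an induction on the degree that splits off one reciprocal root at a time,
  \<open>P = (1 - b z) A\<close>. Then \<open>Q\<close> or \<open>Q*\<close> has the form
  \<open>(1 - b z) B\<close> with \<open>B\<close> cospectral to \<open>A\<close>. With
  \<open>a m\<close> and \<open>c k\<close> for the coefficients of \<open>A\<close> and
  \<open>B\<close>, an equality of moduli of a coefficient of \<open>P\<close> and one of
  \<open>Q\<close> takes the form
  \<open>|a m - b a (m - 1)| = |c k - b c (k - 1)|\<close>. For fixed \<open>A\<close>
  and \<open>B\<close> this confines \<open>b\<close> to a circle or a line unless
  \<open>|a m| = |c k|\<close> and \<open>|a (m - 1)| = |c (k - 1)|\<close>. Here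
  \<open>m\<close> and \<open>k\<close> may differ even if the original indices agree, because passing
  to \<open>Q*\<close> reverses one of them; the property that is carried through the induction
  (\<open>generic\<close>) therefore quantifies over arbitrary pairs of integer indices. For a generic
  \<open>A\<close> the two consecutive equalities cannot hold together except in the trivial case
  (\<open>generic_two_consecutive_moduli\<close>). Since \<open>A\<close> has only finitely many
  cospectral polynomials up to unimodular factors (\<open>finitely_many_cospectral\<close>), only a
  null set of \<open>b\<close> can destroy genericity (\<open>generic_linear_mult\<close>).

  It remains to transport this from pairs \<open>(b, A)\<close> to the coefficients of
  \<open>P\<close> (\<open>null_nongeneric\<close>). For fixed \<open>b\<close> the coefficients of
  \<open>A\<close> are a unitriangular linear function of the coefficients
  \<open>p[0], \<dots>, p[d]\<close> of \<open>P\<close> of degree \<open>d + 1\<close>, so this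
  change of variables preserves Lebesgue measure; for fixed \<open>p[0], \<dots>, p[d]\<close> the
  leading coefficient is a polynomial function of \<open>b\<close>, and such a map from the plane to
  itself sends null sets to null sets. Fubini's theorem joins the two steps. It needs the set of
  nongeneric coefficient vectors to be measurable, which holds because this set is a countable union
  of projections of compact sets (\<open>sets_nongeneric\<close>).
\<close>

section \<open>Cospectral polynomials\<close>

definition conj_reverse :: "complex poly \<Rightarrow> complex poly" where
  "conj_reverse P = map_poly cnj (reflect_poly P)"

text \<open>
  Equality of degrees and nonvanishing of constant terms express that the two signals have the same
  support; without nonzero constant terms reversal would not be an involution.
\<close>

definition cospectral :: "complex poly \<Rightarrow> complex poly \<Rightarrow> bool" where
  "cospectral P Q \<longleftrightarrow> degree Q = degree P \<and> coeff P 0 \<noteq> 0 \<and> coeff Q 0 \<noteq> 0 \<and>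
     (\<forall>z. norm z = 1 \<longrightarrow> norm (poly P z) = norm (poly Q z))"

text \<open>
  Coefficients indexed by the integers: the recursion for \<open>(1 - b z) A\<close> then needs no
  boundary cases, and index reversal is \<open>k \<mapsto> d - k\<close> without truncation.
\<close>

definition zcoeff :: "complex poly \<Rightarrow> int \<Rightarrow> complex" where
  "zcoeff P k = (if k < 0 then 0 else coeff P (nat k))"

lemma coeff_conj_reverse:
  "coeff (conj_reverse P) k = (if k \<le> degree P then cnj (coeff P (degree P - k)) else 0)"
  by (simp add: conj_reverse_def coeff_map_poly coeff_reflect_poly)

lemma degree_conj_reverse: "coeff P 0 \<noteq> 0 \<Longrightarrow> degree (conj_reverse P) = degree P"
  by (simp add: conj_reverse_def degree_map_poly)

lemma coeff_0_conj_reverse: "coeff P 0 \<noteq> 0 \<Longrightarrow> coeff (conj_reverse P) 0 \<noteq> 0"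
  by (auto simp: coeff_conj_reverse)

lemma conj_reverse_conj_reverse: "coeff P 0 \<noteq> 0 \<Longrightarrow> conj_reverse (conj_reverse P) = P"
  by (rule poly_eqI) (auto simp: coeff_conj_reverse degree_conj_reverse coeff_eq_0)

text \<open>
  Reversal is multiplicative for polynomials, and so is conjugation of coefficients, because on values
  it is \<open>z \<mapsto> cnj (P (cnj z))\<close>.
\<close>

lemma conj_reverse_mult: "conj_reverse (P * Q) = conj_reverse P * conj_reverse Q"
proof -
  have "poly (map_poly cnj (p * q)) = poly (map_poly cnj p * map_poly cnj q)" for p q
    by (rule ext) simp
  then have "map_poly cnj (p * q) = map_poly cnj p * map_poly cnj q" for p q
    by (simp only: poly_eq_poly_eq_iff)
  then show ?thesis
    by (simp only: conj_reverse_def reflect_poly_mult)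
qed

lemma conj_reverse_smult: "conj_reverse (smult u P) = smult (cnj u) (conj_reverse P)"
  by (cases "u = 0") (auto intro!: poly_eqI simp: coeff_conj_reverse)

text \<open>
  On the circle \<open>inverse z = cnj z\<close>, so reversing and conjugating the coefficients
  conjugates the value up to a power of \<open>z\<close>. This turns moduli on the circle into
  polynomial identities.
\<close>

lemma poly_conj_reverse_on_circle:
  assumes "norm z = 1"
  shows "poly (conj_reverse P) z = z ^ degree P * cnj (poly P z)"
proof -
  have z: "z \<noteq> 0" "inverse (cnj z) = z"
    using assms by (auto simp: inverse_complex_def complex_eq_iff cmod_def)
  then show ?thesis
    by (simp add: conj_reverse_def poly_reflect_poly_nz)
qed

lemma infinite_unit_circle: "infinite {z::complex. norm z = 1}"
proof -
  have "connected (sphere (0::complex) 1)"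
    by (simp add: connected_sphere)
  moreover have "1 \<in> sphere (0::complex) 1" "-1 \<in> sphere (0::complex) 1"
    by auto
  ultimately have "uncountable (sphere (0::complex) 1)"
    by (rule connected_uncountable) simp
  then show ?thesis
    by (intro uncountable_infinite) (simp add: sphere_def)
qed

lemma poly_eq_on_circle:
  fixes P Q :: "complex poly"
  assumes "\<And>z. norm z = 1 \<Longrightarrow> poly P z = poly Q z"
  shows "P = Q"
proof (rule ccontr)
  assume "P \<noteq> Q"
  then have "finite {z. poly (P - Q) z = 0}"
    by (intro poly_roots_finite) simp
  moreover have "{z. norm z = 1} \<subseteq> {z. poly (P - Q) z = 0}"
    using assms by auto
  ultimately show False
    using infinite_unit_circle finite_subset by blast
qed

lemma poly_mult_conj_reverse_on_circle:
  assumes "norm z = 1"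
  shows "poly (P * conj_reverse P) z = z ^ degree P * of_real ((norm (poly P z))\<^sup>2)"
  unfolding poly_mult poly_conj_reverse_on_circle[OF assms] complex_norm_square by simp

text \<open>
  The coefficients of \<open>P * conj_reverse P\<close> are the autocorrelations of the coefficient
  vector. On the circle this product equals \<open>z ^ degree P * |P|^2\<close>, and a polynomial
  is determined by its values on the circle.
\<close>

lemma cospectral_iff_autocorrelation:
  assumes "degree Q = degree P" "coeff P 0 \<noteq> 0" "coeff Q 0 \<noteq> 0"
  shows "cospectral P Q \<longleftrightarrow> P * conj_reverse P = Q * conj_reverse Q"
proof
  assume "cospectral P Q"
  then show "P * conj_reverse P = Q * conj_reverse Q"
    by (intro poly_eq_on_circle)
      (simp only: poly_mult_conj_reverse_on_circle cospectral_def)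
next
  assume eq: "P * conj_reverse P = Q * conj_reverse Q"
  have "norm (poly P z) = norm (poly Q z)" if z: "norm z = 1" for z
  proof -
    have "z ^ degree P * of_real ((norm (poly P z))\<^sup>2) = z ^ degree P * of_real ((norm (poly Q z))\<^sup>2)"
      using poly_mult_conj_reverse_on_circle[OF z, of P] poly_mult_conj_reverse_on_circle[OF z, of Q]
      unfolding eq assms(1) by simp
    moreover have "z ^ degree P \<noteq> 0"
      using z by auto
    ultimately have "(norm (poly P z))\<^sup>2 = (norm (poly Q z))\<^sup>2"
      by (simp only: mult_cancel_left of_real_eq_iff) simp
    then show ?thesis by simp
  qed
  then show "cospectral P Q"
    using assms by (simp add: cospectral_def)
qed

lemma cospectral_autocorrelation:
  "cospectral P Q \<Longrightarrow> P * conj_reverse P = Q * conj_reverse Q"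
  using cospectral_iff_autocorrelation[of Q P] by (simp add: cospectral_def)

lemma cospectral_conj_reverse:
  assumes "cospectral P Q"
  shows "cospectral P (conj_reverse Q)"
proof -
  have "norm (poly (conj_reverse Q) z) = norm (poly Q z)" if "norm z = 1" for z
    using that by (simp add: poly_conj_reverse_on_circle norm_mult norm_power)
  then show ?thesis
    using assms degree_conj_reverse coeff_0_conj_reverse by (auto simp: cospectral_def)
qed

text \<open>
  A nonzero polynomial cannot vanish on the whole circle, and at a point where it does not the factor
  can be read off.
\<close>

lemma cospectral_smult_unimodular:
  assumes "cospectral P (smult u P)"
  shows "norm u = 1"
proof -
  have "P \<noteq> 0"
    using assms by (auto simp: cospectral_def)
  then obtain z where z: "norm z = 1" "poly P z \<noteq> 0"
    using poly_eq_on_circle[of P 0] by auto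
  then show ?thesis
    using assms by (auto simp: cospectral_def norm_mult)
qed

lemma cospectral_constant:
  assumes "cospectral P Q" "degree P = 0"
  obtains p q where "P = [:p:]" "Q = [:q:]" "p \<noteq> 0" "q \<noteq> 0"
proof -
  have "P = [:coeff P 0:]" "Q = [:coeff Q 0:]"
    using assms by (auto simp: cospectral_def intro: degree_0_id[symmetric])
  then show ?thesis
    using that assms by (metis cospectral_def)
qed

text \<open>
  Cancelling in the polynomial identity \<open>P P* = Q Q*\<close> avoids any discussion of zeros
  of \<open>L\<close> on the circle.
\<close>

lemma cospectral_cancel:
  assumes "cospectral (L * A) (L * B)"
  shows "cospectral A B"
proof -
  have nz: "coeff L 0 \<noteq> 0" "coeff A 0 \<noteq> 0" "coeff B 0 \<noteq> 0"
    using assms by (auto simp: cospectral_def coeff_mult)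
  then have "L \<noteq> 0" "A \<noteq> 0" "B \<noteq> 0" "conj_reverse L \<noteq> 0"
    using coeff_0_conj_reverse[of L] by auto
  moreover have deg: "degree B = degree A"
    using assms calculation by (simp add: cospectral_def degree_mult_eq)
  moreover have "L * A * conj_reverse (L * A) = L * B * conj_reverse (L * B)"
    by (rule cospectral_autocorrelation[OF assms])
  then have "(L * conj_reverse L) * (A * conj_reverse A) = (L * conj_reverse L) * (B * conj_reverse B)"
    by (simp add: conj_reverse_mult mult_ac)
  ultimately have "A * conj_reverse A = B * conj_reverse B"
    by (simp only: mult_cancel_left mult_eq_0_iff) blast
  then show ?thesis
    using cospectral_iff_autocorrelation[OF deg nz(2,3)] by blast
qed

lemma cospectral_divide_common_root:
  assumes "cospectral ([:1, -b:] * A) Q" "b \<noteq> 0" "poly Q (1 / b) = 0"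
  shows "\<exists>B. cospectral A B \<and> Q = [:1, -b:] * B"
proof -
  obtain C where "Q = [:-(1 / b), 1:] * C"
    using assms(3) poly_eq_0_iff_dvd by (metis dvdE)
  moreover have "[:-(1 / b), 1:] = smult (-(1 / b)) [:1, -b:]"
    using assms(2) by simp
  ultimately have "Q = [:1, -b:] * smult (-(1 / b)) C"
    by (metis mult_smult_left mult_smult_right)
  then show ?thesis
    using assms(1) cospectral_cancel by blast
qed

text \<open>
  The root \<open>1 / b\<close> of \<open>P P* = Q Q*\<close> is a root of \<open>Q\<close> or
  of \<open>Q*\<close>. Replacing \<open>Q\<close> by \<open>Q*\<close> in the second case means that
  the same factor \<open>1 - b z\<close> can always be divided out, so that reflected roots need no
  separate treatment.
\<close>

lemma cospectral_divide_linear: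
  assumes "cospectral ([:1, -b:] * A) Q" "b \<noteq> 0"
  shows "\<exists>B. cospectral A B \<and> (Q = [:1, -b:] * B \<or> conj_reverse Q = [:1, -b:] * B)"
proof -
  let ?P = "[:1, -b:] * A"
  have "?P * conj_reverse ?P = Q * conj_reverse Q"
    by (rule cospectral_autocorrelation[OF assms(1)])
  moreover have "poly [:1, -b:] (1 / b) = 0"
    using assms(2) by simp
  ultimately have "poly Q (1 / b) * poly (conj_reverse Q) (1 / b) = 0"
    by (metis mult_zero_left poly_mult)
  then show ?thesis
    using cospectral_divide_common_root[OF assms] 
      cospectral_divide_common_root[OF cospectral_conj_reverse[OF assms(1)] assms(2)]
    by (metis mult_eq_0_iff)
qed

lemma split_linear_factor:
  assumes "degree P = Suc d" "coeff P 0 \<noteq> (0::complex)"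
  shows "\<exists>b A. b \<noteq> 0 \<and> P = [:1, -b:] * A \<and> degree A = d \<and> coeff A 0 \<noteq> 0"
proof -
  have "\<not> constant (poly P)"
    using assms(1) by (simp add: constant_degree)
  then obtain r where r: "poly P r = 0"
    using fundamental_theorem_of_algebra by blast
  then have r0: "r \<noteq> 0"
    using assms(2) by (auto simp: poly_0_coeff_0)
  obtain C where "P = [:-r, 1:] * C"
    using r poly_eq_0_iff_dvd by (metis dvdE)
  moreover have "[:-r, 1:] = smult (-r) [:1, -(1 / r):]"
    using r0 by simp
  ultimately have P: "P = [:1, -(1 / r):] * smult (-r) C"
    by (metis mult_smult_left mult_smult_right)
  moreover have "coeff (smult (-r) C) 0 \<noteq> 0"
    using assms(2) P by (simp add: coeff_mult)
  moreover have "degree (smult (-r) C) = d"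
  proof -
    have "smult (-r) C \<noteq> 0"
      using \<open>coeff (smult (-r) C) 0 \<noteq> 0\<close> by (metis coeff_0)
    then have "degree P = degree [:1, -(1 / r):] + degree (smult (-r) C)"
      unfolding P by (intro degree_mult_eq) auto
    then show ?thesis using assms(1) r0 by simp
  qed
  ultimately show ?thesis
    using r0 by (intro exI[of _ "1 / r"] exI[of _ "smult (-r) C"]) auto
qed

text \<open>
  Each linear factor of \<open>P\<close> leaves two possibilities for the corresponding factor of
  \<open>Q\<close>, so there are at most \<open>2 ^ d\<close> classes.
\<close>

lemma finitely_many_cospectral:
  "coeff P 0 \<noteq> 0 \<Longrightarrow>
     \<exists>F. finite F \<and> (\<forall>Q. cospectral P Q \<longrightarrow> (\<exists>B\<in>F. \<exists>u. norm u = 1 \<and> Q = smult u B))"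
proof (induction "degree P" arbitrary: P)
  case 0
  have "\<exists>u. norm u = 1 \<and> Q = smult u P" if PQ: "cospectral P Q" for Q
  proof -
    obtain p q where "P = [:p:]" "Q = [:q:]" "p \<noteq> 0"
      using PQ 0(1)[symmetric] by (rule cospectral_constant)
    then have Q: "Q = smult (q / p) P"
      by simp
    then have "norm (q / p) = 1"
      using that cospectral_smult_unimodular by blast
    with Q show ?thesis by blast
  qed
  then show ?case
    by (intro exI[of _ "{P}"]) auto
next
  case (Suc d)
  obtain b A where A: "b \<noteq> 0" "P = [:1, -b:] * A" "degree A = d" "coeff A 0 \<noteq> 0"
    using split_linear_factor Suc by metis
  obtain F where F: "finite F"
    "\<And>Q. cospectral A Q \<Longrightarrow> \<exists>B\<in>F. \<exists>u. norm u = 1 \<and> Q = smult u B"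
    using Suc.hyps(1)[OF A(3)[symmetric] A(4)] by metis
  define G where "G = (\<lambda>B. [:1, -b:] * B) ` F \<union> (\<lambda>B. conj_reverse ([:1, -b:] * B)) ` F"
  have "\<exists>B\<in>G. \<exists>u. norm u = 1 \<and> Q = smult u B" if Q: "cospectral P Q" for Q
  proof -
    obtain B where B: "cospectral A B" "Q = [:1, -b:] * B \<or> conj_reverse Q = [:1, -b:] * B"
      using cospectral_divide_linear Q A by blast
    obtain C u where C: "C \<in> F" "norm u = 1" "B = smult u C"
      using F(2) B(1) by metis
    show ?thesis
    proof (cases "Q = [:1, -b:] * B")
      case True
      then show ?thesis
        unfolding C(3) mult_smult_right G_def using C by blast
    next
      case False
      then have "conj_reverse Q = [:1, -b:] * B"
        using B(2) by simp
      then have "Q = conj_reverse ([:1, -b:] * B)"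
        using conj_reverse_conj_reverse[of Q] Q by (simp add: cospectral_def)
      then have "Q = smult (cnj u) (conj_reverse ([:1, -b:] * C))"
        unfolding C(3) mult_smult_right conj_reverse_smult .
      moreover have "norm (cnj u) = 1"
        using C(2) by simp
      ultimately show ?thesis
        unfolding G_def using C(1) by blast
    qed
  qed
  moreover have "finite G"
    using F(1) by (simp add: G_def)
  ultimately show ?case by blast
qed

lemma zcoeff_out_of_range: "k < 0 \<or> int (degree P) < k \<Longrightarrow> zcoeff P k = 0"
  by (auto simp: zcoeff_def intro: coeff_eq_0)

lemma zcoeff_smult: "zcoeff (smult u P) k = u * zcoeff P k"
  by (simp add: zcoeff_def)

lemma zcoeff_linear_mult: "zcoeff ([:1, -b:] * A) k = zcoeff A k - b * zcoeff A (k - 1)"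
proof (cases "k \<le> 0")
  case True
  then show ?thesis
    by (cases "k = 0") (auto simp: zcoeff_def)
next
  case False
  define j where "j = nat (k - 1)"
  have "nat k = Suc j" "k > 0"
    using False by (auto simp: j_def)
  then show ?thesis
    by (simp add: zcoeff_def j_def[symmetric])
qed

lemma norm_zcoeff_conj_reverse:
  assumes "coeff P 0 \<noteq> 0"
  shows "norm (zcoeff (conj_reverse P) (int (degree P) - k)) = norm (zcoeff P k)"
proof (cases "0 \<le> k \<and> k \<le> int (degree P)")
  case True
  then have "nat (int (degree P) - k) \<le> degree P" "degree P - nat (int (degree P) - k) = nat k"
    by linarith+
  then show ?thesis
    using True by (simp add: zcoeff_def coeff_conj_reverse)
next
  case False
  then show ?thesis
    using zcoeff_out_of_range[of k P]
      zcoeff_out_of_range[of "int (degree P) - k" "conj_reverse P"]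
      degree_conj_reverse[OF assms] by auto
qed

text \<open>
  The two alternatives in the conclusion are the trivial coincidences: \<open>Q\<close> is a rotation
  of \<open>P\<close> and the indices agree, or \<open>Q\<close> is a rotated reflection of
  \<open>P\<close> and the indices correspond under reversal. Only one of the two indices is required
  to lie in the range, so genericity also says that no coefficient of \<open>P\<close>, or of any
  polynomial cospectral to it, vanishes; the induction meets such pairs, since \<open>m - 1\<close>
  and \<open>k - 1\<close> may leave the range of \<open>A\<close>.
\<close>

definition generic :: "complex poly \<Rightarrow> bool" where
  "generic P \<longleftrightarrow> coeff P 0 \<noteq> 0 \<and>
     (\<forall>Q m k. cospectral P Q \<longrightarrow> {m, k} \<inter> {0..int (degree P)} \<noteq> {} \<longrightarrow>
        norm (zcoeff P m) = norm (zcoeff Q k) \<longrightarrow>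
        (\<exists>u. Q = smult u P) \<and> k = m \<or>
        (\<exists>u. conj_reverse Q = smult u P) \<and> k = int (degree P) - m)"

lemma generic_constant:
  assumes "degree P = 0" "coeff P 0 \<noteq> 0"
  shows "generic P"
  unfolding generic_def
proof (intro conjI allI impI disjI1)
  fix Q m k
  assume Q: "cospectral P Q" and r: "{m, k} \<inter> {0..int (degree P)} \<noteq> {}"
    and eq: "norm (zcoeff P m) = norm (zcoeff Q k)"
  obtain p q where pq: "P = [:p:]" "Q = [:q:]" "p \<noteq> 0" "q \<noteq> 0"
    using Q assms(1) by (rule cospectral_constant)
  then show "\<exists>u. Q = smult u P"
    using assms by (intro exI[of _ "q / p"]) simp
  have "zcoeff P m = (if m = 0 then p else 0)" "zcoeff Q k = (if k = 0 then q else 0)"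
    using zcoeff_out_of_range[of k Q] zcoeff_out_of_range[of m P] pq by (auto simp: zcoeff_def)
  then show "k = m"
    using r eq assms pq(3,4) by (auto split: if_splits)
qed (use assms in auto)

lemma genericD:
  assumes "generic P" "cospectral P Q" "{m, k} \<inter> {0..int (degree P)} \<noteq> {}"
    "norm (zcoeff P m) = norm (zcoeff Q k)"
  shows "(\<exists>u. Q = smult u P) \<and> k = m \<or>
        (\<exists>u. conj_reverse Q = smult u P) \<and> k = int (degree P) - m"
  using assms unfolding generic_def by blast

text \<open>
  By genericity each of the two equalities gives \<open>k = m\<close> or a reversal of indices. The
  reversals are \<open>k = d - m\<close> and \<open>k - 1 = d - (m - 1)\<close>, with
  \<open>d\<close> the degree of \<open>A\<close>, and these contradict each other. Genericity does
  not apply to a pair with both indices out of range. If this happens to one of the two pairs, then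
  reversal in the other forces \<open>d = 0\<close> and \<open>k = m\<close>, and constants are
  proportional anyway.
\<close>

lemma generic_two_consecutive_moduli:
  assumes gen: "generic A" and AB: "cospectral A B"
    and range: "{m, k} \<inter> {0..int (degree A) + 1} \<noteq> {}"
    and eq0: "norm (zcoeff A m) = norm (zcoeff B k)"
    and eq1: "norm (zcoeff A (m - 1)) = norm (zcoeff B (k - 1))"
  shows "(\<exists>u. B = smult u A) \<and> k = m"
proof -
  have const: "\<exists>u. B = smult u A" if d: "degree A = 0"
  proof -
    obtain a b where "A = [:a:]" "B = [:b:]" "a \<noteq> 0"
      using AB d by (rule cospectral_constant)
    then show ?thesis
      by (intro exI[of _ "b / a"]) simp
  qed
  show ?thesis
  proof (cases "{m, k} \<inter> {0..int (degree A)} \<noteq> {}")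
    case True
    note alt0 = genericD[OF gen AB True eq0]
    show ?thesis
    proof (cases "{m - 1, k - 1} \<inter> {0..int (degree A)} \<noteq> {}")
      case True
      show ?thesis
        using alt0 genericD[OF gen AB True eq1] by auto
    next
      case False
      show ?thesis
      proof (cases "k = m")
        case True
        with False \<open>{m, k} \<inter> {0..int (degree A)} \<noteq> {}\<close> alt0 const show ?thesis
          by auto
      next
        case neq: False
        then have "k = int (degree A) - m"
          using alt0 by blast
        with False \<open>{m, k} \<inter> {0..int (degree A)} \<noteq> {}\<close> neq have False
          by auto
        then show ?thesis ..
      qed
    qed
  next
    case False
    then have in1: "{m - 1, k - 1} \<inter> {0..int (degree A)} \<noteq> {}"
      using range by auto
    note alt1 = genericD[OF gen AB in1 eq1]
    show ?thesis
    proof (cases "k = m")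
      case True
      with False in1 alt1 const show ?thesis
        by auto
    next
      case neq: False
      then have "k - 1 = int (degree A) - (m - 1)"
        using alt1 by auto
      with False in1 neq have False
        by auto
      then show ?thesis ..
    qed
  qed
qed

text \<open>
  Squaring gives a real equation in \<open>b\<close> whose quadratic part is a multiple of
  \<open>|b|^2\<close>. It describes a circle, possibly degenerate or empty, if that multiple is
  nonzero; otherwise the constant term is nonzero and the equation describes a line or the empty set.
\<close>

lemma negligible_equal_moduli:
  fixes a a' c c' :: complex
  assumes "norm a \<noteq> norm c \<or> norm a' \<noteq> norm c'"
  shows "negligible {b. norm (a - b * a') = norm (c - b * c')}"
proof -
  define s where "s = (norm a')\<^sup>2 - (norm c')\<^sup>2"
  define t where "t = (norm a)\<^sup>2 - (norm c)\<^sup>2"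
  define w where "w = a * cnj a' - c * cnj c'"
  have expand: "(norm (x - b * y))\<^sup>2 = (norm x)\<^sup>2 + (norm y)\<^sup>2 * (norm b)\<^sup>2 - 2 * ((x * cnj y) \<bullet> b)"
    for x y b :: complex
    by (simp add: cmod_power2 inner_complex_def) (simp add: power2_eq_square algebra_simps)
  have iff: "norm (a - b * a') = norm (c - b * c') \<longleftrightarrow> s * (norm b)\<^sup>2 + t = 2 * (w \<bullet> b)" for b
  proof -
    have "norm (a - b * a') = norm (c - b * c') \<longleftrightarrow> (norm (a - b * a'))\<^sup>2 = (norm (c - b * c'))\<^sup>2"
      by simp
    then show ?thesis
      unfolding expand s_def t_def w_def inner_diff_left by argo
  qed
  show ?thesis
  proof (cases "s = 0")
    case True
    then have "t \<noteq> 0"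
      using assms by (auto simp: s_def t_def)
    then have "negligible {b. w \<bullet> b = t / 2}"
      by (intro negligible_hyperplane) simp
    then show ?thesis
      by (rule negligible_subset) (auto simp: iff True)
  next
    case False
    define v where "v = w /\<^sub>R s"
    have "norm (b - v) = sqrt ((norm v)\<^sup>2 - t / s)" if "s * (norm b)\<^sup>2 + t = 2 * (w \<bullet> b)" for b
    proof -
      have "(norm (b - v))\<^sup>2 = (norm b)\<^sup>2 - 2 * (v \<bullet> b) + (norm v)\<^sup>2"
        by (simp add: power2_norm_eq_inner inner_diff_left inner_diff_right inner_commute)
      also have "\<dots> = (norm b)\<^sup>2 - 2 * (w \<bullet> b) / s + (norm v)\<^sup>2"
        by (simp add: v_def divide_inverse mult_ac)
      also have "\<dots> = (norm v)\<^sup>2 - t / s"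
        using that[symmetric] False by (simp add: field_simps)
      finally show ?thesis
        by (metis norm_ge_zero real_sqrt_unique)
    qed
    then have "{b. norm (a - b * a') = norm (c - b * c')} \<subseteq> sphere v (sqrt ((norm v)\<^sup>2 - t / s))"
      by (auto simp: iff dist_norm norm_minus_commute)
    then show ?thesis
      using negligible_sphere negligible_subset by blast
  qed
qed

lemma degree_linear_mult:
  fixes b :: complex
  assumes "b \<noteq> 0" "A \<noteq> 0"
  shows "degree ([:1, -b:] * A) = Suc (degree A)"
proof -
  have "degree ([:1, -b:] * A) = degree [:1, -b:] + degree A"
    by (rule degree_mult_eq) (use assms in auto)
  then show ?thesis using assms by simp
qed

text \<open>
  Each bad \<open>b\<close> satisfies an equality of moduli for one of countably many choices of a
  representative \<open>B\<close> cospectral to \<open>A\<close> and of two indices. The choices are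
  restricted to those for which the equality has a negligible solution set; for the others
  \<open>A\<close> and \<open>B\<close> have equal moduli at two consecutive indices, and then the
  coincidence is trivial.
\<close>

lemma generic_linear_mult:
  assumes gen: "generic A"
  shows "negligible {b. b \<noteq> 0 \<and> \<not> generic ([:1, -b:] * A)}"
proof -
  have A0: "coeff A 0 \<noteq> 0"
    using gen by (simp add: generic_def)
  obtain F where F: "finite F"
    "\<And>Q. cospectral A Q \<Longrightarrow> \<exists>B\<in>F. \<exists>u. norm u = 1 \<and> Q = smult u B"
    using finitely_many_cospectral[OF A0] by metis
  define T where "T = (\<lambda>(B, m, k). {b. norm (zcoeff A m - b * zcoeff A (m - 1)) =
      norm (zcoeff B k - b * zcoeff B (k - 1))})"
  define I where "I = {(B, m, k). B \<in> F \<and> negligible (T (B, m, k))}"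
  have "countable I"
  proof (rule countable_subset)
    show "I \<subseteq> F \<times> (UNIV :: (int \<times> int) set)"
      by (auto simp: I_def)
    show "countable (F \<times> (UNIV :: (int \<times> int) set))"
      using F(1) by (simp add: countable_finite)
  qed
  then have "negligible (\<Union>i\<in>I. T i)"
    by (intro negligible_countable_Union) (auto simp: I_def)
  moreover have "b \<in> (\<Union>i\<in>I. T i)" if b0: "b \<noteq> 0" and nongen: "\<not> generic ([:1, -b:] * A)" for b
  proof (rule ccontr)
    assume notin: "b \<notin> (\<Union>i\<in>I. T i)"
    let ?P = "[:1, -b:] * A"
    have P0: "coeff ?P 0 \<noteq> 0"
      using A0 by (simp add: coeff_mult)
    have deg: "degree ?P = Suc (degree A)"
      using A0 by (intro degree_linear_mult b0) auto
    have key: "(\<exists>u. B = smult u A) \<and> k = m"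
      if AB: "cospectral A B" and range: "{m, k} \<inter> {0..int (degree A) + 1} \<noteq> {}"
        and eq: "norm (zcoeff ?P m) = norm (zcoeff ([:1, -b:] * B) k)" for B m k
    proof -
      obtain C u where C: "C \<in> F" "norm u = 1" "B = smult u C"
        using F(2) AB by metis
      \<comment> \<open>The set \<open>T\<close> is unchanged when \<open>B\<close> is multiplied by a unimodular constant.\<close>
      have "zcoeff B k - b * zcoeff B (k - 1) = u * (zcoeff C k - b * zcoeff C (k - 1))"
        by (simp add: C zcoeff_smult algebra_simps)
      then have "b \<in> T (C, m, k)"
        using eq C(2) by (simp add: T_def zcoeff_linear_mult norm_mult del: mult_pCons_left)
      then have "\<not> negligible (T (C, m, k))"
        using notin C(1) by (auto simp: I_def)
      then have "norm (zcoeff A m) = norm (zcoeff C k)" "norm (zcoeff A (m - 1)) = norm (zcoeff C (k - 1))"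
        using negligible_equal_moduli unfolding T_def by auto
      then show ?thesis
        using generic_two_consecutive_moduli[OF gen AB range] C by (simp add: zcoeff_smult norm_mult)
    qed
    have "generic ?P"
      unfolding generic_def
    proof (intro conjI allI impI P0)
      fix Q m k
      assume Q: "cospectral ?P Q" and range: "{m, k} \<inter> {0..int (degree ?P)} \<noteq> {}"
        and eq: "norm (zcoeff ?P m) = norm (zcoeff Q k)"
      have Q0: "coeff Q 0 \<noteq> 0" "degree Q = degree ?P"
        using Q by (auto simp: cospectral_def)
      obtain B where B: "cospectral A B" "Q = [:1, -b:] * B \<or> conj_reverse Q = [:1, -b:] * B"
        using cospectral_divide_linear Q b0 by blast
      show "(\<exists>u. Q = smult u ?P) \<and> k = m \<or>
        (\<exists>u. conj_reverse Q = smult u ?P) \<and> k = int (degree ?P) - m"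
        using B(2)
      proof
        assume QB: "Q = [:1, -b:] * B"
        have "(\<exists>u. B = smult u A) \<and> k = m"
          using key[OF B(1) _ eq[unfolded QB]] range deg by (simp add: add.commute)
        then show ?thesis
          unfolding QB by (metis mult_smult_right)
      next
        assume QB: "conj_reverse Q = [:1, -b:] * B"
        have "norm (zcoeff ?P m) = norm (zcoeff ([:1, -b:] * B) (int (degree ?P) - k))"
          using eq norm_zcoeff_conj_reverse[OF Q0(1), of k] Q0(2) QB by metis
        then have "(\<exists>u. B = smult u A) \<and> int (degree ?P) - k = m"
          using range unfolding deg by (intro key[OF B(1)]) auto
        then show ?thesis
          unfolding QB by (metis mult_smult_right diff_diff_eq2 add_diff_cancel_left')
      qed
    qed
    with nongen show False by simp
  qed
  then have "{b. b \<noteq> 0 \<and> \<not> generic ([:1, -b:] * A)} \<subseteq> (\<Union>i\<in>I. T i)"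
    by blast
  ultimately show ?thesis
    by (rule negligible_subset)
qed

section \<open>Lebesgue measure on tuples\<close>

interpretation lborel_product: product_sigma_finite "\<lambda>_. lborel :: 'a::euclidean_space measure"
  by standard

lemma nn_integral_PiM_Suc:
  fixes f :: "(nat \<Rightarrow> 'a::euclidean_space) \<Rightarrow> ennreal"
  assumes "f \<in> borel_measurable (PiM {..<Suc n} (\<lambda>_. lborel))"
  shows "(\<integral>\<^sup>+x. f x \<partial>PiM {..<Suc n} (\<lambda>_. lborel)) =
    (\<integral>\<^sup>+x. \<integral>\<^sup>+y. f (x(n := y)) \<partial>lborel \<partial>PiM {..<n} (\<lambda>_. lborel))"
  using assms unfolding lessThan_Suc by (intro lborel_product.product_nn_integral_insert) auto

lemma measurable_PiM_upd_Suc [measurable]: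
  "(\<lambda>(x, y). x(n := y)) \<in> PiM {..<n} (\<lambda>_. lborel) \<Otimes>\<^sub>M lborel \<rightarrow>\<^sub>M PiM {..<Suc n} (\<lambda>_. lborel :: 'a::euclidean_space measure)"
  unfolding lessThan_Suc by (rule measurable_add_dim)

lemma nn_integral_lborel_translation:
  fixes f :: "'a::euclidean_space \<Rightarrow> ennreal"
  assumes [measurable]: "f \<in> borel_measurable borel"
  shows "(\<integral>\<^sup>+y. f (y + c) \<partial>lborel) = (\<integral>\<^sup>+y. f y \<partial>lborel)"
proof -
  have "(\<integral>\<^sup>+y. f y \<partial>lborel) = (\<integral>\<^sup>+y. f y \<partial>distr lborel borel ((+) c))"
    by (simp add: lborel_distr_plus)
  also have "\<dots> = (\<integral>\<^sup>+y. f (y + c) \<partial>lborel)"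
    by (subst nn_integral_distr) (auto simp: add.commute)
  finally show ?thesis ..
qed

text \<open>
  Integrate the last coordinate first. Given the earlier coordinates it is merely translated, and
  after removing the translation the remaining coordinates are transformed by a map of the same kind.
\<close>

lemma nn_integral_unitriangular:
  fixes f :: "(nat \<Rightarrow> 'a::euclidean_space) \<Rightarrow> ennreal" and h :: "nat \<Rightarrow> (nat \<Rightarrow> 'a) \<Rightarrow> 'a"
  assumes h [measurable]: "\<And>i. h i \<in> borel_measurable (PiM {..<i} (\<lambda>_. lborel))"
    and dep: "\<And>i x y. (\<And>j. j < i \<Longrightarrow> x j = y j) \<Longrightarrow> h i x = h i y"
    and f: "f \<in> borel_measurable (PiM {..<n} (\<lambda>_. lborel))"
  shows "(\<integral>\<^sup>+x. f (\<lambda>i\<in>{..<n}. x i + h i x) \<partial>PiM {..<n} (\<lambda>_. lborel)) =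
    (\<integral>\<^sup>+x. f x \<partial>PiM {..<n} (\<lambda>_. lborel))"
  using f
proof (induction n arbitrary: f)
  case 0
  then show ?case
    by (intro nn_integral_cong) (auto simp: space_PiM restrict_def fun_eq_iff PiE_iff extensional_def intro!: arg_cong[of _ _ f])
next
  case (Suc n)
  define L where "L m x = (\<lambda>i\<in>{..<m}. x i + h i x)" for m x
  have hm: "h i \<in> borel_measurable (PiM {..<m} (\<lambda>_. lborel))" if "i \<le> m" for i m
  proof -
    have "(\<lambda>x. h i (restrict x {..<i})) \<in> borel_measurable (PiM {..<m} (\<lambda>_. lborel))"
      using that by (intro measurable_compose[OF measurable_restrict_subset h]) auto
    moreover have "h i (restrict x {..<i}) = h i x" for x
      by (rule dep) auto
    ultimately show ?thesis by simp
  qed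
  have Lm [measurable]: "L m \<in> PiM {..<m} (\<lambda>_. lborel) \<rightarrow>\<^sub>M PiM {..<m} (\<lambda>_. lborel)" for m
    unfolding L_def using hm by (intro measurable_restrict) (auto intro!: borel_measurable_add)
  note [measurable] = Suc.prems
  have upd: "L (Suc n) (x(n := y)) = (L n x)(n := y + h n x)" for x y
    using dep[of _ "x(n := y)" x] by (auto simp: L_def fun_eq_iff less_Suc_eq)
  have "(\<integral>\<^sup>+x. f (L (Suc n) x) \<partial>PiM {..<Suc n} (\<lambda>_. lborel)) =
      (\<integral>\<^sup>+x. \<integral>\<^sup>+y. f ((L n x)(n := y + h n x)) \<partial>lborel \<partial>PiM {..<n} (\<lambda>_. lborel))"
    by (subst nn_integral_PiM_Suc) (auto simp: upd)
  also have "\<dots> = (\<integral>\<^sup>+x. \<integral>\<^sup>+y. f ((L n x)(n := y)) \<partial>lborel \<partial>PiM {..<n} (\<lambda>_. lborel))"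
  proof (rule nn_integral_cong)
    fix x :: "nat \<Rightarrow> 'a" assume x: "x \<in> space (PiM {..<n} (\<lambda>_. lborel))"
    then have "L n x \<in> space (PiM {..<n} (\<lambda>_. lborel))"
      using measurable_space[OF Lm] by blast
    then have "(\<lambda>y. f ((L n x)(n := y))) \<in> borel_measurable borel"
      using measurable_compose[OF measurable_Pair1' measurable_compose[OF measurable_PiM_upd_Suc Suc.prems]]
      by fastforce
    then show "(\<integral>\<^sup>+y. f ((L n x)(n := y + h n x)) \<partial>lborel) = (\<integral>\<^sup>+y. f ((L n x)(n := y)) \<partial>lborel)"
      by (rule nn_integral_lborel_translation)
  qed
  also have "\<dots> = (\<integral>\<^sup>+x. \<integral>\<^sup>+y. f (x(n := y)) \<partial>lborel \<partial>PiM {..<n} (\<lambda>_. lborel))"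
  proof -
    have "(\<lambda>x. \<integral>\<^sup>+y. f (x(n := y)) \<partial>lborel) \<in> borel_measurable (PiM {..<n} (\<lambda>_. lborel))"
      by measurable
    from Suc.IH[OF this] show ?thesis
      unfolding L_def .
  qed
  also have "\<dots> = (\<integral>\<^sup>+x. f x \<partial>PiM {..<Suc n} (\<lambda>_. lborel))"
    by (subst nn_integral_PiM_Suc) auto
  finally show ?case
    unfolding L_def .
qed

text \<open>
  Tonelli's theorem, with the last coordinate as the inner variable.
\<close>

lemma null_sets_PiM_Suc:
  fixes X :: "(nat \<Rightarrow> 'a::euclidean_space) set"
  assumes X: "X \<in> sets (PiM {..<Suc n} (\<lambda>_. lborel))"
    and null: "AE x in PiM {..<n} (\<lambda>_. lborel). AE y in lborel. x(n := y) \<notin> X"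
  shows "X \<in> null_sets (PiM {..<Suc n} (\<lambda>_. lborel))"
proof -
  have "emeasure (PiM {..<Suc n} (\<lambda>_. lborel)) X = (\<integral>\<^sup>+x. indicator X x \<partial>PiM {..<Suc n} (\<lambda>_. lborel))"
    using X by simp
  also have "\<dots> = (\<integral>\<^sup>+x. \<integral>\<^sup>+y. indicator X (x(n := y)) \<partial>lborel \<partial>PiM {..<n} (\<lambda>_. lborel))"
    using X by (intro nn_integral_PiM_Suc) auto
  also have "\<dots> = (\<integral>\<^sup>+x. 0 \<partial>PiM {..<n} (\<lambda>_. (lborel :: 'a measure)))"
  proof (rule nn_integral_cong_AE, use null in eventually_elim)
    case (elim x)
    have "(\<integral>\<^sup>+y. indicator X (x(n := y)) \<partial>lborel) = (\<integral>\<^sup>+y. 0 \<partial>(lborel :: 'a measure))"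
      by (rule nn_integral_cong_AE, use elim in eventually_elim) simp
    then show ?case by simp
  qed
  finally show ?thesis
    using X by auto
qed

lemma AE_notin_unitriangular:
  fixes N :: "(nat \<Rightarrow> 'a::euclidean_space) set" and h :: "nat \<Rightarrow> (nat \<Rightarrow> 'a) \<Rightarrow> 'a"
  assumes h: "\<And>i. h i \<in> borel_measurable (PiM {..<i} (\<lambda>_. lborel))"
    and dep: "\<And>i x y. (\<And>j. j < i \<Longrightarrow> x j = y j) \<Longrightarrow> h i x = h i y"
    and N: "N \<in> null_sets (PiM {..<n} (\<lambda>_. lborel))"
    and L: "(\<lambda>x. \<lambda>i\<in>{..<n}. x i + h i x) \<in> PiM {..<n} (\<lambda>_. lborel) \<rightarrow>\<^sub>M PiM {..<n} (\<lambda>_. lborel)"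
  shows "AE x in PiM {..<n} (\<lambda>_. lborel). (\<lambda>i\<in>{..<n}. x i + h i x) \<notin> N"
proof -
  have [measurable]: "N \<in> sets (PiM {..<n} (\<lambda>_. lborel))"
    using N by auto
  have "(\<integral>\<^sup>+x. indicator N (\<lambda>i\<in>{..<n}. x i + h i x) \<partial>PiM {..<n} (\<lambda>_. lborel)) =
      (\<integral>\<^sup>+x. indicator N x \<partial>PiM {..<n} (\<lambda>_. lborel))"
    by (rule nn_integral_unitriangular[OF h dep]) auto
  also have "\<dots> = 0"
    using N by auto
  finally have "AE x in PiM {..<n} (\<lambda>_. lborel). indicator N (\<lambda>i\<in>{..<n}. x i + h i x) = (0::ennreal)"
    using measurable_compose[OF L borel_measurable_indicator[of N]] by (subst (asm) nn_integral_0_iff_AE) auto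
  then show ?thesis
    by eventually_elim (auto simp: indicator_def split: if_splits)
qed

lemma measurable_Complex [measurable]:
  "(\<lambda>(x, y). Complex x y) \<in> borel_measurable (borel \<Otimes>\<^sub>M borel)"
  unfolding borel_prod by (intro borel_measurable_continuous_onI) (auto simp: split_def intro!: continuous_intros)

lemma lborel_complex_eq_distr:
  "(lborel :: complex measure) = distr (lborel \<Otimes>\<^sub>M lborel) borel (\<lambda>(x, y). Complex x y)"
proof (rule lborel_eqI)
  have [measurable]: "(\<lambda>(x, y). Complex x y) \<in> borel_measurable (lborel \<Otimes>\<^sub>M lborel)"
    using measurable_Complex by (simp cong: measurable_cong_sets)
  fix l u :: complex
  assume le: "\<And>b. b \<in> Basis \<Longrightarrow> l \<bullet> b \<le> u \<bullet> b"
  have le': "Re l \<le> Re u" "Im l \<le> Im u"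
    using le[of 1] le[of \<i>] by (auto simp: Basis_complex_def)
  have "(\<lambda>(x, y). Complex x y) -` box l u \<inter> space (lborel \<Otimes>\<^sub>M lborel) =
      {Re l <..< Re u} \<times> {Im l <..< Im u}"
    by (auto simp: box_def Basis_complex_def inner_complex_def space_pair_measure)
  then show "emeasure (distr (lborel \<Otimes>\<^sub>M lborel) borel (\<lambda>(x, y). Complex x y)) (box l u) = (\<Prod>b\<in>Basis. (u - l) \<bullet> b)"
    using le' by (subst emeasure_distr)
      (auto simp: lborel.emeasure_pair_measure_Times Basis_complex_def inner_complex_def ennreal_mult)
qed simp

lemma nn_integral_complex:
  assumes [measurable]: "f \<in> borel_measurable borel"
  shows "(\<integral>\<^sup>+z. f z \<partial>lborel) = (\<integral>\<^sup>+x. \<integral>\<^sup>+y. f (Complex x y) \<partial>lborel \<partial>lborel)"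
proof -
  have [measurable]: "(\<lambda>(x, y). Complex x y) \<in> borel_measurable (lborel \<Otimes>\<^sub>M lborel)"
    using measurable_Complex by (simp cong: measurable_cong_sets)
  have "(\<integral>\<^sup>+z. f z \<partial>lborel) = (\<integral>\<^sup>+v. f (case v of (x, y) \<Rightarrow> Complex x y) \<partial>(lborel \<Otimes>\<^sub>M lborel))"
    by (subst lborel_complex_eq_distr, subst nn_integral_distr) auto
  also have "\<dots> = (\<integral>\<^sup>+x. \<integral>\<^sup>+y. f (Complex x y) \<partial>lborel \<partial>lborel)"
    by (subst lborel.nn_integral_fst[symmetric]) (auto simp: split_def)
  finally show ?thesis .
qed

text \<open>
  The inverse of the interleaving of real and imaginary parts.
\<close>

definition complexify :: "nat \<Rightarrow> (nat \<Rightarrow> real) \<Rightarrow> nat \<Rightarrow> complex" where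
  "complexify n v = (\<lambda>j\<in>{..<n}. Complex (v (2 * j)) (v (2 * j + 1)))"

lemma measurable_complexify [measurable]:
  "complexify n \<in> PiM {..<2 * n} (\<lambda>_. lborel) \<rightarrow>\<^sub>M PiM {..<n} (\<lambda>_. lborel)"
  unfolding complexify_def
proof (rule measurable_restrict)
  fix j assume "j \<in> {..<n}"
  then have [measurable]: "(\<lambda>v. v (2 * j)) \<in> borel_measurable (PiM {..<2 * n} (\<lambda>_. lborel :: real measure))"
    "(\<lambda>v. v (2 * j + 1)) \<in> borel_measurable (PiM {..<2 * n} (\<lambda>_. lborel :: real measure))"
    using measurable_component_singleton[of _ "{..<2 * n}" "\<lambda>_. lborel :: real measure"] by auto
  have "(\<lambda>v. (v (2 * j), v (2 * j + 1))) \<in> PiM {..<2 * n} (\<lambda>_. lborel) \<rightarrow>\<^sub>M borel \<Otimes>\<^sub>M (borel :: real measure)"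
    by measurable
  from measurable_compose[OF this measurable_Complex]
  show "(\<lambda>v. Complex (v (2 * j)) (v (2 * j + 1))) \<in> PiM {..<2 * n} (\<lambda>_. lborel) \<rightarrow>\<^sub>M lborel"
    by simp
qed

text \<open>
  The real coordinates are integrated out in pairs, each pair being one complex coordinate.
\<close>

lemma nn_integral_complexify:
  assumes "f \<in> borel_measurable (PiM {..<n} (\<lambda>_. lborel))"
  shows "(\<integral>\<^sup>+v. f (complexify n v) \<partial>PiM {..<2 * n} (\<lambda>_. lborel)) =
    (\<integral>\<^sup>+x. f x \<partial>PiM {..<n} (\<lambda>_. lborel))"
  using assms
proof (induction n arbitrary: f)
  case 0
  then show ?case
    by (simp add: complexify_def PiM_empty nn_integral_count_space_finite)
next
  case (Suc n)
  note [measurable] = Suc.prems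
  have upd: "complexify (Suc n) (v(2 * n := s, Suc (2 * n) := t)) = (complexify n v)(n := Complex s t)" for v s t
    by (auto simp: complexify_def fun_eq_iff)
  have f1: "(\<lambda>v. f (complexify (Suc n) v)) \<in> borel_measurable (PiM {..<Suc (Suc (2 * n))} (\<lambda>_. lborel))"
    using measurable_compose[OF measurable_complexify Suc.prems] by simp
  have f2: "(\<lambda>v. \<integral>\<^sup>+t. f (complexify (Suc n) (v(Suc (2 * n) := t))) \<partial>lborel) \<in>
      borel_measurable (PiM {..<Suc (2 * n)} (\<lambda>_. lborel))"
    using f1 by measurable
  have "(\<integral>\<^sup>+v. f (complexify (Suc n) v) \<partial>PiM {..<Suc (Suc (2 * n))} (\<lambda>_. lborel)) =
    (\<integral>\<^sup>+v. \<integral>\<^sup>+s. \<integral>\<^sup>+t. f ((complexify n v)(n := Complex s t)) \<partial>lborel \<partial>lborel \<partial>PiM {..<2 * n} (\<lambda>_. lborel))"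
    by (simp add: nn_integral_PiM_Suc[OF f1] nn_integral_PiM_Suc[OF f2] upd)
  also have "\<dots> = (\<integral>\<^sup>+v. \<integral>\<^sup>+z. f ((complexify n v)(n := z)) \<partial>lborel \<partial>PiM {..<2 * n} (\<lambda>_. lborel))"
  proof (intro nn_integral_cong nn_integral_complex[symmetric])
    fix v :: "nat \<Rightarrow> real" assume "v \<in> space (PiM {..<2 * n} (\<lambda>_. lborel))"
    then have "complexify n v \<in> space (PiM {..<n} (\<lambda>_. lborel))"
      using measurable_space[OF measurable_complexify] by blast
    then show "(\<lambda>z. f ((complexify n v)(n := z))) \<in> borel_measurable borel"
      using measurable_compose[OF measurable_Pair1' measurable_compose[OF measurable_PiM_upd_Suc Suc.prems]]
      by fastforce
  qed
  also have "\<dots> = (\<integral>\<^sup>+x. \<integral>\<^sup>+z. f (x(n := z)) \<partial>lborel \<partial>PiM {..<n} (\<lambda>_. lborel))"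
    by (rule Suc.IH) measurable
  also have "\<dots> = (\<integral>\<^sup>+x. f x \<partial>PiM {..<Suc n} (\<lambda>_. lborel))"
    by (subst nn_integral_PiM_Suc) auto
  finally show ?case by simp
qed

lemma null_sets_vimage_complexify:
  assumes N: "N \<in> null_sets (PiM {..<n} (\<lambda>_. lborel))"
  shows "complexify n -` N \<inter> space (PiM {..<2 * n} (\<lambda>_. lborel)) \<in> null_sets (PiM {..<2 * n} (\<lambda>_. lborel))"
proof -
  have Ns [measurable]: "N \<in> sets (PiM {..<n} (\<lambda>_. lborel))"
    using N by auto
  have m: "complexify n -` N \<inter> space (PiM {..<2 * n} (\<lambda>_. lborel)) \<in> sets (PiM {..<2 * n} (\<lambda>_. lborel))"
    by measurable
  have "emeasure (PiM {..<2 * n} (\<lambda>_. lborel)) (complexify n -` N \<inter> space (PiM {..<2 * n} (\<lambda>_. lborel))) =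
      (\<integral>\<^sup>+v. indicator N (complexify n v) \<partial>PiM {..<2 * n} (\<lambda>_. lborel))"
    unfolding nn_integral_indicator[OF m, symmetric]
    by (intro nn_integral_cong) (auto split: split_indicator)
  also have "\<dots> = (\<integral>\<^sup>+x. indicator N x \<partial>PiM {..<n} (\<lambda>_. lborel))"
    by (rule nn_integral_complexify) auto
  also have "\<dots> = 0"
    using N by auto
  finally show ?thesis
    using m by auto
qed

section \<open>Measurability of the set of nongeneric polynomials\<close>

definition poly_of :: "nat \<Rightarrow> (nat \<Rightarrow> complex) \<Rightarrow> complex poly" where
  "poly_of n p = (\<Sum>i<n. monom (p i) i)"

lemma coeff_poly_of: "coeff (poly_of n p) k = (if k < n then p k else 0)"
  by (simp add: poly_of_def coeff_sum coeff_monom)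

lemma poly_poly_of: "poly (poly_of n p) z = (\<Sum>i<n. p i * z ^ i)"
  by (simp add: poly_of_def poly_sum poly_monom)

lemma degree_poly_of: "p d \<noteq> 0 \<Longrightarrow> degree (poly_of (Suc d) p) = d"
  by (intro order_antisym degree_le le_degree) (auto simp: coeff_poly_of)

lemma poly_of_coeff:
  assumes "degree P < n"
  shows "poly_of n (\<lambda>i. if i < n then coeff P i else c) = P"
  using assms by (intro poly_eqI) (auto simp: coeff_poly_of coeff_eq_0)

text \<open>
  Restricting to exact degree \<open>d\<close> and nonzero constant term matches the support condition
  on signals, and it makes the set empty for \<open>d = 0\<close>, where the induction starts.
\<close>

definition nongeneric :: "nat \<Rightarrow> (nat \<Rightarrow> complex) set" where
  "nongeneric d = {p \<in> space (PiM {..<Suc d} (\<lambda>_. lborel)).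
     p 0 \<noteq> 0 \<and> p d \<noteq> 0 \<and> \<not> generic (poly_of (Suc d) p)}"

text \<open>
  A continuous function of \<open>p\<close> and \<open>q\<close> that vanishes exactly if these
  vectors are linearly dependent.
\<close>

definition proportionality_defect :: "nat \<Rightarrow> (nat \<Rightarrow> complex) \<Rightarrow> (nat \<Rightarrow> complex) \<Rightarrow> real" where
  "proportionality_defect d p q = (\<Sum>i\<le>d. \<Sum>j\<le>d. norm (p i * q j - p j * q i))"

lemma proportionality_defect_eq_0_iff:
  assumes "p 0 \<noteq> 0"
  shows "proportionality_defect d p q = 0 \<longleftrightarrow> (\<exists>u. \<forall>i\<le>d. q i = u * p i)"
proof
  assume "proportionality_defect d p q = 0"
  then have "p 0 * q j - p j * q 0 = 0" if "j \<le> d" for j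
    using that by (auto simp: proportionality_defect_def sum_nonneg_eq_0_iff sum_nonneg)
  then have "\<forall>j\<le>d. q j = (q 0 / p 0) * p j"
    using assms by (simp add: field_simps)
  then show "\<exists>u. \<forall>i\<le>d. q i = u * p i" by blast
next
  assume "\<exists>u. \<forall>i\<le>d. q i = u * p i"
  then show "proportionality_defect d p q = 0"
    by (auto simp: proportionality_defect_def intro!: sum.neutral)
qed

lemma proportionality_defect_nonneg: "proportionality_defect d p q \<ge> 0"
  by (simp add: proportionality_defect_def sum_nonneg)

text \<open>
  Up to the factors that force full degree and nonzero constant terms, this is nonzero exactly if
  neither of the two trivial coincidences in the definition of \<open>generic\<close> occurs for the
  indices \<open>m\<close> and \<open>k\<close>. Being a continuous function, it expresses this open
  condition as a countable union of closed conditions, nontriviality at least \<open>1 / r\<close>.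
\<close>

definition nontriviality :: "nat \<Rightarrow> int \<Rightarrow> int \<Rightarrow> (nat \<Rightarrow> complex) \<Rightarrow> (nat \<Rightarrow> complex) \<Rightarrow> real" where
  "nontriviality d m k p q = norm (p 0) * norm (p d) * norm (q 0) * norm (q d) *
     (if k = m then proportionality_defect d p q else 1) *
     (if k = int d - m then proportionality_defect d p (\<lambda>i. cnj (q (d - i))) else 1)"

lemma nontriviality_nonneg: "nontriviality d m k p q \<ge> 0"
  by (simp add: nontriviality_def proportionality_defect_nonneg)

text \<open>
  The coordinates beyond \<open>d\<close> are fixed at the value \<open>undefined\<close> that they
  have in the product measure space; the box is thus compact as a set of functions on all natural
  numbers.
\<close>

definition coef_box :: "nat \<Rightarrow> real \<Rightarrow> (nat \<Rightarrow> complex) set" where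
  "coef_box d r = PiE UNIV (\<lambda>i. if i \<le> d then cball 0 r else {undefined})"

text \<open>
  Pairs in which \<open>q\<close> violates genericity of \<open>p\<close> at the indices
  \<open>m\<close> and \<open>k\<close>, cut down to a compact set by the bound \<open>r\<close> on
  all coefficients and the lower bound \<open>1 / r\<close> on the nontriviality.
\<close>

definition counterexamples ::
  "nat \<Rightarrow> int \<Rightarrow> int \<Rightarrow> real \<Rightarrow> ((nat \<Rightarrow> complex) \<times> (nat \<Rightarrow> complex)) set" where
  "counterexamples d m k r = (coef_box d r \<times> coef_box d r) \<inter>
     {(p, q). 1 \<le> r * nontriviality d m k p q} \<inter>
     {(p, q). norm (zcoeff (poly_of (Suc d) p) m) = norm (zcoeff (poly_of (Suc d) q) k)} \<inter>
     (\<Inter>z\<in>{z. norm z = 1}.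
        {(p, q). norm (poly (poly_of (Suc d) p) z) = norm (poly (poly_of (Suc d) q) z)})"

lemma compact_coef_box: "compact (coef_box d r)"
proof -
  have "compactin (product_topology (\<lambda>i. euclidean) UNIV) (coef_box d r)"
    unfolding coef_box_def compactin_PiE by auto
  then show ?thesis
    by (simp add: euclidean_product_topology)
qed

lemma continuous_on_coordinate_fst:
  "continuous_on S (\<lambda>x :: ('i \<Rightarrow> 'a::topological_space) \<times> 'b::topological_space. fst x i)"
  by (rule continuous_on_compose2[OF continuous_on_product_coordinates continuous_on_fst[OF continuous_on_id]]) simp

lemma continuous_on_coordinate_snd:
  "continuous_on S (\<lambda>x :: 'b::topological_space \<times> ('i \<Rightarrow> 'a::topological_space). snd x i)"
  by (rule continuous_on_compose2[OF continuous_on_product_coordinates continuous_on_snd[OF continuous_on_id]]) simp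

lemma compact_counterexamples: "compact (counterexamples d m k r)"
proof -
  note cont = continuous_on_coordinate_fst continuous_on_coordinate_snd
  have zc: "zcoeff (poly_of (Suc d) p) j = (if 0 \<le> j \<and> j \<le> int d then p (nat j) else 0)" for p j
    by (auto simp: zcoeff_def coeff_poly_of)
  have if_cont: "continuous_on S (\<lambda>x. if c then f x else 0)" if "continuous_on S f"
    for c S and f :: "'x::topological_space \<Rightarrow> complex"
    using that by (cases c) auto
  have "continuous_on UNIV (\<lambda>x. nontriviality d m k (fst x) (snd x))"
    unfolding nontriviality_def proportionality_defect_def
    by (cases "k = m"; cases "k = int d - m") (simp; intro continuous_intros cont)+
  then have "closed {(p, q). 1 \<le> r * nontriviality d m k p q}"
    unfolding split_def by (intro closed_Collect_le continuous_intros) auto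
  moreover have "continuous_on UNIV (\<lambda>x. zcoeff (poly_of (Suc d) (fst x)) j)"
    "continuous_on UNIV (\<lambda>x. zcoeff (poly_of (Suc d) (snd x)) j)" for j
    unfolding zc by (intro if_cont cont)+
  then have "closed {(p, q). norm (zcoeff (poly_of (Suc d) p) m) = norm (zcoeff (poly_of (Suc d) q) k)}"
    unfolding split_def by (intro closed_Collect_eq continuous_on_norm)
  moreover have "closed {(p, q). norm (poly (poly_of (Suc d) p) z) = norm (poly (poly_of (Suc d) q) z)}" for z
    unfolding split_def poly_poly_of by (intro closed_Collect_eq continuous_intros cont)
  ultimately show ?thesis
    unfolding counterexamples_def
    by (intro compact_Int_closed closed_INT compact_Times compact_coef_box) auto
qed

lemma in_coef_box_iff:
  "p \<in> coef_box d r \<longleftrightarrow> (\<forall>i\<le>d. norm (p i) \<le> r) \<and> p \<in> extensional {..<Suc d}"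
proof -
  have "p i \<in> (if i \<le> d then cball 0 r else {undefined}) \<longleftrightarrow>
      (i \<le> d \<longrightarrow> norm (p i) \<le> r) \<and> (i \<notin> {..<Suc d} \<longrightarrow> p i = undefined)" for i
    by auto
  then show ?thesis
    by (simp only: coef_box_def PiE_UNIV_domain Pi_iff extensional_def mem_Collect_eq) blast
qed

lemma conj_reverse_proportional_iff:
  assumes "q d \<noteq> 0"
  shows "(\<exists>u. conj_reverse (poly_of (Suc d) q) = smult u (poly_of (Suc d) p)) \<longleftrightarrow>
    (\<exists>u. \<forall>i\<le>d. cnj (q (d - i)) = u * p i)"
proof -
  have "coeff (conj_reverse (poly_of (Suc d) q)) i = coeff (smult u (poly_of (Suc d) p)) i \<longleftrightarrow>
      (i \<le> d \<longrightarrow> cnj (q (d - i)) = u * p i)" for u i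
    using degree_poly_of[of q d] assms by (simp add: coeff_conj_reverse coeff_poly_of less_Suc_eq_le)
  then show ?thesis
    unfolding poly_eq_iff by blast
qed

lemma proportional_iff:
  "(\<exists>u. poly_of (Suc d) q = smult u (poly_of (Suc d) p)) \<longleftrightarrow> (\<exists>u. \<forall>i\<le>d. q i = u * p i)"
proof -
  have "coeff (poly_of (Suc d) q) i = coeff (smult u (poly_of (Suc d) p)) i \<longleftrightarrow>
      (i \<le> d \<longrightarrow> q i = u * p i)" for u i
    by (simp add: coeff_poly_of less_Suc_eq_le)
  then show ?thesis
    unfolding poly_eq_iff by blast
qed

lemma nontriviality_neq_0_iff:
  "nontriviality d m k p q \<noteq> 0 \<longleftrightarrow> p 0 \<noteq> 0 \<and> p d \<noteq> 0 \<and> q 0 \<noteq> 0 \<and> q d \<noteq> 0 \<and>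
     \<not> ((\<exists>u. poly_of (Suc d) q = smult u (poly_of (Suc d) p)) \<and> k = m \<or>
        (\<exists>u. conj_reverse (poly_of (Suc d) q) = smult u (poly_of (Suc d) p)) \<and> k = int d - m)"
proof (cases "p 0 \<noteq> 0 \<and> p d \<noteq> 0 \<and> q 0 \<noteq> 0 \<and> q d \<noteq> 0")
  case True
  then show ?thesis
    using proportionality_defect_eq_0_iff[of p d q] proportionality_defect_eq_0_iff[of p d "\<lambda>i. cnj (q (d - i))"]
    unfolding proportional_iff conj_reverse_proportional_iff[of q, OF conjunct2[OF conjunct2[OF conjunct2[OF True]]]]
    by (simp add: nontriviality_def)
next
  case False
  then show ?thesis by (auto simp: nontriviality_def)
qed

text \<open>
  Existence of a counterexample \<open>q\<close> is a projection. Projections of Borel sets need not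
  be Borel, but the projections of the compact sets on the right are compact.
\<close>

lemma nongeneric_eq_projections:
  "nongeneric d = (\<Union>(m, k)\<in>{(m, k). {m, k} \<inter> {0..int d} \<noteq> {}}.
     \<Union>r::nat. fst ` counterexamples d m k (real r))"
proof (intro equalityI subsetI)
  fix p assume p: "p \<in> nongeneric d"
  let ?P = "poly_of (Suc d) p"
  have p0: "p 0 \<noteq> 0" "p d \<noteq> 0" "p \<in> extensional {..<Suc d}" "\<not> generic ?P"
    using p by (auto simp: nongeneric_def space_PiM PiE_iff)
  have deg: "degree ?P = d"
    using p0 degree_poly_of by blast
  obtain Q m k where Q: "cospectral ?P Q" "{m, k} \<inter> {0..int d} \<noteq> {}"
    "norm (zcoeff ?P m) = norm (zcoeff Q k)"
    "\<not> ((\<exists>u. Q = smult u ?P) \<and> k = m \<or> (\<exists>u. conj_reverse Q = smult u ?P) \<and> k = int d - m)"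
    using p0 unfolding generic_def deg by (auto simp: coeff_poly_of)
  define q where "q = (\<lambda>i. if i < Suc d then coeff Q i else undefined)"
  have degQ: "degree Q = d" "coeff Q 0 \<noteq> 0"
    using Q(1) deg by (auto simp: cospectral_def)
  then have qQ: "poly_of (Suc d) q = Q"
    unfolding q_def by (intro poly_of_coeff) simp
  have q0: "q 0 \<noteq> 0" "q d \<noteq> 0" "q \<in> extensional {..<Suc d}"
    using degQ by (auto simp: q_def extensional_def)
  have w: "nontriviality d m k p q \<noteq> 0"
    unfolding nontriviality_neq_0_iff qQ using p0 q0 Q(4) by blast
  \<comment> \<open>One number bounds all coefficients and the reciprocal of the nontriviality.\<close>
  obtain r :: nat where r: "1 / nontriviality d m k p q + (\<Sum>i\<le>d. norm (p i) + norm (q i)) \<le> real r"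
    using real_arch_simple by blast
  have w0: "nontriviality d m k p q > 0"
    using w nontriviality_nonneg[of d m k p q] by simp
  have "0 \<le> (\<Sum>i\<le>d. norm (p i) + norm (q i))"
    by (intro sum_nonneg) auto
  then have "1 / nontriviality d m k p q \<le> real r"
    using r by linarith
  then have "1 \<le> real r * nontriviality d m k p q"
    using w0 by (simp add: field_simps)
  moreover have "norm (p i) \<le> real r" "norm (q i) \<le> real r" if "i \<le> d" for i
  proof -
    have "norm (p i) + norm (q i) \<le> (\<Sum>i\<le>d. norm (p i) + norm (q i))"
      using that by (intro member_le_sum) auto
    moreover have "0 \<le> 1 / nontriviality d m k p q"
      using w0 by simp
    ultimately have "norm (p i) + norm (q i) \<le> real r"
      using r by linarith
    then show "norm (p i) \<le> real r" "norm (q i) \<le> real r"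
      using norm_ge_zero[of "p i"] norm_ge_zero[of "q i"] by linarith+
  qed
  ultimately have "(p, q) \<in> counterexamples d m k (real r)"
    using p0 q0 Q qQ by (auto simp: counterexamples_def in_coef_box_iff cospectral_def)
  then have "p \<in> fst ` counterexamples d m k (real r)"
    by force
  then show "p \<in> (\<Union>(m, k)\<in>{(m, k). {m, k} \<inter> {0..int d} \<noteq> {}}.
     \<Union>r::nat. fst ` counterexamples d m k (real r))"
    using Q(2) by blast
next
  fix p assume "p \<in> (\<Union>(m, k)\<in>{(m, k). {m, k} \<inter> {0..int d} \<noteq> {}}.
     \<Union>r::nat. fst ` counterexamples d m k (real r))"
  then obtain m k q and r :: nat where
    range: "{m, k} \<inter> {0..int d} \<noteq> {}" and ce: "(p, q) \<in> counterexamples d m k (real r)"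
    by fastforce
  then have w: "nontriviality d m k p q \<noteq> 0" and ext: "p \<in> extensional {..<Suc d}"
    and eq: "norm (zcoeff (poly_of (Suc d) p) m) = norm (zcoeff (poly_of (Suc d) q) k)"
    and circ: "\<And>z. norm z = 1 \<Longrightarrow> norm (poly (poly_of (Suc d) p) z) = norm (poly (poly_of (Suc d) q) z)"
    by (auto simp: counterexamples_def in_coef_box_iff)
  note w' = w[unfolded nontriviality_neq_0_iff]
  have deg: "degree (poly_of (Suc d) p) = d" "degree (poly_of (Suc d) q) = d"
    using w' degree_poly_of by blast+
  have "cospectral (poly_of (Suc d) p) (poly_of (Suc d) q)"
    using deg w' circ by (auto simp: cospectral_def coeff_poly_of)
  then have "\<not> generic (poly_of (Suc d) p)"
    using genericD[of "poly_of (Suc d) p" "poly_of (Suc d) q" m k] w' range eq unfolding deg by blast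
  then show "p \<in> nongeneric d"
    using ext w' by (simp add: nongeneric_def space_PiM PiE_iff)
qed

lemma sets_nongeneric: "nongeneric d \<in> sets (PiM {..<Suc d} (\<lambda>_. lborel))"
proof -
  let ?M = "PiM {..<Suc d} (\<lambda>_. lborel :: complex measure)"
  have "closed (fst ` counterexamples d m k r)" for m k r
    by (intro compact_imp_closed compact_continuous_image[OF _ compact_counterexamples] continuous_intros)
  then have "nongeneric d \<in> sets borel"
    unfolding nongeneric_eq_projections by (intro sets.countable_UN'') (auto intro: borel_closed)
  moreover have "(\<lambda>p. p) \<in> borel_measurable ?M"
  proof (rule measurable_coordinatewise_then_product)
    fix i
    show "(\<lambda>p. p i) \<in> borel_measurable ?M"
    proof (cases "i < Suc d")
      case True
      then have "(\<lambda>p. p i) \<in> ?M \<rightarrow>\<^sub>M (lborel :: complex measure)"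
        by (intro measurable_component_singleton) auto
      then show ?thesis by simp
    next
      case False
      then have "p i = undefined" if "p \<in> space ?M" for p
        using that by (auto simp: space_PiM PiE_iff extensional_def)
      then show ?thesis
        using measurable_cong[of ?M "\<lambda>p. p i" "\<lambda>_. undefined"] by simp
    qed
  qed
  ultimately have "(\<lambda>p. p) -` nongeneric d \<inter> space ?M \<in> sets ?M"
    by (rule measurable_sets[rotated])
  moreover have "(\<lambda>p. p) -` nongeneric d \<inter> space ?M = nongeneric d"
    by (auto simp: nongeneric_def)
  ultimately show ?thesis by simp
qed

section \<open>Almost every polynomial is generic\<close>

text \<open>
  With \<open>P = (1 - b z) A\<close>, that is \<open>A = P / (1 - b z)\<close> as power
  series, the coefficient of index \<open>i\<close> of \<open>A\<close> is
  \<open>p i + tail_sum b i p\<close>. If \<open>b \<noteq> 0\<close>, a polynomial of degree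
  \<open>n\<close> is divisible by \<open>1 - b z\<close> exactly if
  \<open>p n = - tail_sum b n p\<close>.
\<close>

definition tail_sum :: "complex \<Rightarrow> nat \<Rightarrow> (nat \<Rightarrow> complex) \<Rightarrow> complex" where
  "tail_sum b i p = (\<Sum>k<i. b ^ (i - k) * p k)"

definition linear_mult :: "nat \<Rightarrow> complex \<Rightarrow> (nat \<Rightarrow> complex) \<Rightarrow> nat \<Rightarrow> complex" where
  "linear_mult n b a =
     (\<lambda>i\<in>{..<Suc n}. (if i < n then a i else 0) - b * (if i = 0 then 0 else a (i - 1)))"

definition linear_quotient :: "nat \<Rightarrow> complex \<Rightarrow> (nat \<Rightarrow> complex) \<Rightarrow> nat \<Rightarrow> complex" where
  "linear_quotient n b p = (\<lambda>i\<in>{..<n}. p i + tail_sum b i p)"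

lemma tail_sum_Suc: "tail_sum b (Suc i) p = b * (p i + tail_sum b i p)"
  by (simp add: tail_sum_def sum_distrib_left algebra_simps Suc_diff_le)

lemma poly_of_linear_mult:
  "poly_of (Suc n) (linear_mult n b a) = [:1, -b:] * poly_of n a"
proof (rule poly_eqI)
  fix i
  show "coeff (poly_of (Suc n) (linear_mult n b a)) i = coeff ([:1, -b:] * poly_of n a) i"
    by (cases i) (auto simp: coeff_poly_of linear_mult_def coeff_pCons)
qed

lemma linear_mult_linear_quotient:
  assumes "p \<in> extensional {..<n}"
  shows "linear_mult n b (linear_quotient n b p) = p(n := - tail_sum b n p)"
proof
  fix i
  consider "i > n" | "i = n" | "i < n" by linarith
  then show "linear_mult n b (linear_quotient n b p) i = (p(n := - tail_sum b n p)) i"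
    using assms tail_sum_Suc[of b "i - 1" p]
    by cases (auto simp: linear_mult_def linear_quotient_def extensional_def tail_sum_def[of b 0])
qed

lemma measurable_coordinate_PiM:
  "i < n \<Longrightarrow> (\<lambda>x. x i) \<in> borel_measurable (PiM {..<n} (\<lambda>_. lborel :: complex measure))"
  using measurable_component_singleton[of i "{..<n}" "\<lambda>_. lborel :: complex measure"] by simp

lemma measurable_tail_sum [measurable]:
  "i \<le> n \<Longrightarrow> (\<lambda>(x, b). tail_sum b i x) \<in> borel_measurable (PiM {..<n} (\<lambda>_. lborel) \<Otimes>\<^sub>M lborel)"
  unfolding tail_sum_def split_def
  by (intro borel_measurable_sum borel_measurable_times borel_measurable_power
      measurable_compose[OF measurable_fst measurable_coordinate_PiM])
    (auto intro: measurable_compose[OF measurable_snd])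

lemma measurable_linear_mult:
  "(\<lambda>(a, b). linear_mult n b a) \<in> PiM {..<n} (\<lambda>_. lborel) \<Otimes>\<^sub>M lborel \<rightarrow>\<^sub>M PiM {..<Suc n} (\<lambda>_. lborel)"
  unfolding linear_mult_def split_def
proof (rule measurable_restrict)
  fix i assume i: "i \<in> {..<Suc n}"
  have [measurable]: "(\<lambda>x. fst x j) \<in> borel_measurable (PiM {..<n} (\<lambda>_. lborel :: complex measure) \<Otimes>\<^sub>M (lborel :: complex measure))"
    if "j < n" for j
    using that by (intro measurable_compose[OF measurable_fst measurable_coordinate_PiM])
  have [measurable]: "snd \<in> borel_measurable (PiM {..<n} (\<lambda>_. lborel :: complex measure) \<Otimes>\<^sub>M (lborel :: complex measure))"
    by (auto intro: measurable_compose[OF measurable_snd])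
  consider "n = 0" | "i = 0" "i < n" | "0 < i" "i < n" | "0 < i" "i = n"
    using i by fastforce
  then show "(\<lambda>x. (if i < n then fst x i else 0) - snd x * (if i = 0 then 0 else fst x (i - 1)))
      \<in> PiM {..<n} (\<lambda>_. lborel :: complex measure) \<Otimes>\<^sub>M (lborel :: complex measure) \<rightarrow>\<^sub>M lborel"
    using i by cases (auto intro!: borel_measurable_diff borel_measurable_times)
qed

lemma measurable_linear_quotient:
  "(\<lambda>(p, b). linear_quotient n b p) \<in> PiM {..<n} (\<lambda>_. lborel) \<Otimes>\<^sub>M lborel \<rightarrow>\<^sub>M PiM {..<n} (\<lambda>_. lborel)"
  unfolding linear_quotient_def split_def
proof (rule measurable_restrict)
  fix i assume i: "i \<in> {..<n}"
  have coord: "(\<lambda>x. fst x i) \<in> borel_measurable (PiM {..<n} (\<lambda>_. lborel :: complex measure) \<Otimes>\<^sub>M (lborel :: complex measure))"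
    using i by (intro measurable_compose[OF measurable_fst measurable_coordinate_PiM]) auto
  have tail: "(\<lambda>x. tail_sum (snd x) i (fst x)) \<in> borel_measurable (PiM {..<n} (\<lambda>_. lborel) \<Otimes>\<^sub>M lborel)"
    using measurable_tail_sum[OF less_imp_le, of i n] i unfolding split_def by blast
  show "(\<lambda>x. fst x i + tail_sum (snd x) i (fst x))
      \<in> PiM {..<n} (\<lambda>_. lborel) \<Otimes>\<^sub>M lborel \<rightarrow>\<^sub>M lborel"
    using borel_measurable_add[OF coord tail] by simp
qed

lemma sets_Collect_notin:
  assumes "f \<in> M \<rightarrow>\<^sub>M N" "X \<in> sets N"
  shows "{x \<in> space M. f x \<notin> X} \<in> sets M"
proof -
  have "{x \<in> space M. f x \<notin> X} = space M - (f -` X \<inter> space M)"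
    by auto
  then show ?thesis
    using measurable_sets[OF assms] by simp
qed

lemma AE_lborel_notin_iff: "(AE x in lborel. x \<notin> S) \<longleftrightarrow> negligible (S :: 'a::euclidean_space set)"
  by (simp add: negligible_iff_null_sets completion.AE_iff_null_sets AE_completion_iff[symmetric, of _ lborel])

text \<open>
  In the inductive step let \<open>n = d + 1\<close>. Genericity of \<open>(1 - b z) A\<close>
  for almost all \<open>A\<close> and \<open>b\<close> becomes, by the measure preserving substitution
  \<open>A = P / (1 - b z)\<close> for each fixed \<open>b\<close>, a statement about almost
  all \<open>p 0, \<dots>, p (n - 1)\<close> and \<open>b\<close>. For fixed
  \<open>p 0, \<dots>, p (n - 1)\<close> every admissible leading coefficient \<open>w\<close>
  is \<open>- tail_sum b n p\<close> for some \<open>b\<close>, by the fundamental theorem of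
  algebra, so the bad values of \<open>w\<close> are contained in the differentiable image of a null
  set of values of \<open>b\<close>.
\<close>

lemma null_nongeneric: "nongeneric d \<in> null_sets (PiM {..<Suc d} (\<lambda>_. lborel))"
proof (induction d)
  case 0
  have "nongeneric 0 = {}"
    using generic_constant[OF degree_poly_of[of _ 0]] by (auto simp: nongeneric_def coeff_poly_of)
  then show ?case by simp
next
  case (Suc d)
  define n where "n = Suc d"
  let ?M = "PiM {..<n} (\<lambda>_. lborel :: complex measure)"
  interpret M: sigma_finite_measure ?M
    by (intro lborel_product.sigma_finite) simp
  interpret pair: pair_sigma_finite ?M "lborel :: complex measure" ..
  have X [measurable]: "nongeneric n \<in> sets (PiM {..<Suc n} (\<lambda>_. lborel))"
    by (rule sets_nongeneric)
  have IH: "AE a in ?M. a \<notin> nongeneric d"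
    using AE_not_in[OF Suc.IH] unfolding n_def .
  have "AE a in ?M. AE b in lborel. linear_mult n b a \<notin> nongeneric n"
    using IH AE_space
  proof eventually_elim
    case (elim a)
    let ?A = "poly_of n a"
    have "{b. linear_mult n b a \<in> nongeneric n} \<subseteq> {b. b \<noteq> 0 \<and> \<not> generic ([:1, -b:] * ?A)}"
      by (auto simp: nongeneric_def poly_of_linear_mult) (simp add: linear_mult_def n_def)
    moreover have "negligible {b. linear_mult n b a \<in> nongeneric n}"
    proof (cases "generic ?A")
      case True
      then show ?thesis
        using generic_linear_mult calculation negligible_subset by blast
    next
      case False
      then have "a 0 = 0 \<or> a d = 0"
        using elim by (auto simp: nongeneric_def n_def)
      then have "{b. linear_mult n b a \<in> nongeneric n} = {}"
        by (auto simp: nongeneric_def linear_mult_def n_def)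
      then show ?thesis by simp
    qed
    ultimately show ?case
      using AE_lborel_notin_iff[of "{b. linear_mult n b a \<in> nongeneric n}"] by simp
  qed
  then have "AE b in lborel. AE a in ?M. linear_mult n b a \<notin> nongeneric n"
    using sets_Collect_notin[OF measurable_linear_mult[of n] X] unfolding split_def
    by (subst (asm) pair.AE_commute)
  \<comment> \<open>For fixed \<open>b\<close>, substitute the quotient \<open>P / (1 - b z)\<close> for \<open>A\<close>.\<close>
  then have "AE b in lborel. AE p in ?M. linear_mult n b (linear_quotient n b p) \<notin> nongeneric n"
  proof eventually_elim
    case (elim b)
    define N where "N = {a \<in> space ?M. linear_mult n b a \<in> nongeneric n}"
    have mult: "linear_mult n b \<in> ?M \<rightarrow>\<^sub>M PiM {..<Suc n} (\<lambda>_. lborel)"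
      using measurable_compose[OF measurable_Pair2' measurable_linear_mult[of n], of b] by simp
    have quot: "linear_quotient n b \<in> ?M \<rightarrow>\<^sub>M ?M"
      using measurable_compose[OF measurable_Pair2' measurable_linear_quotient[of n], of b] by simp
    have "N \<in> sets ?M"
      unfolding N_def using mult by measurable
    then have "N \<in> null_sets ?M"
      using elim by (subst AE_iff_null_sets) (auto simp: N_def elim: eventually_mono)
    then have "AE p in ?M. (\<lambda>i\<in>{..<n}. p i + tail_sum b i p) \<notin> N"
    proof (intro AE_notin_unitriangular)
      fix i
      show "tail_sum b i \<in> borel_measurable (PiM {..<i} (\<lambda>_. lborel))"
        using measurable_compose[OF measurable_Pair2' measurable_tail_sum[of i i], of b] by simp
    next
      fix i and x y :: "nat \<Rightarrow> complex" assume "\<And>j. j < i \<Longrightarrow> x j = y j"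
      then show "tail_sum b i x = tail_sum b i y"
        by (auto simp: tail_sum_def)
    qed (use quot in \<open>simp_all add: linear_quotient_def[abs_def]\<close>)
    then show ?case
      using AE_space
    proof eventually_elim
      case (elim p)
      then show ?case
        using measurable_space[OF quot] by (auto simp: N_def linear_quotient_def)
    qed
  qed
  moreover have "{x \<in> space (?M \<Otimes>\<^sub>M lborel). linear_mult n (snd x) (linear_quotient n (snd x) (fst x)) \<notin> nongeneric n}
      \<in> sets (?M \<Otimes>\<^sub>M lborel)"
  proof -
    have "(\<lambda>x. (linear_quotient n (snd x) (fst x), snd x)) \<in> ?M \<Otimes>\<^sub>M lborel \<rightarrow>\<^sub>M ?M \<Otimes>\<^sub>M lborel"
      using measurable_linear_quotient[of n] by (intro measurable_Pair) (auto simp: split_def)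
    from sets_Collect_notin[OF measurable_compose[OF this measurable_linear_mult[of n]] X] show ?thesis
      by (simp only: split_conv)
  qed
  ultimately have "AE p in ?M. AE b in lborel. linear_mult n b (linear_quotient n b p) \<notin> nongeneric n"
    by (subst pair.AE_commute)
  \<comment> \<open>For fixed lower coefficients, pass from \<open>b\<close> to the leading coefficient \<open>w\<close>.\<close>
  then have "AE p in ?M. AE w in lborel. p(n := w) \<notin> nongeneric n"
    using AE_space
  proof eventually_elim
    case (elim p)
    let ?T = "{b. p(n := - tail_sum b n p) \<in> nongeneric n}"
    have "p \<in> extensional {..<n}"
      using elim by (simp add: space_PiM PiE_iff)
    then have T: "negligible ?T"
      using elim AE_lborel_notin_iff[of ?T] by (simp add: linear_mult_linear_quotient)
    have "w \<in> (\<lambda>b. - tail_sum b n p) ` ?T" if w: "p(n := w) \<in> nongeneric n" for w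
    proof -
      let ?P = "poly_of (Suc n) (p(n := w))"
      have nz: "p 0 \<noteq> 0" "w \<noteq> 0"
        using w by (auto simp: nongeneric_def n_def)
      have "degree ?P = Suc d" "coeff ?P 0 \<noteq> 0"
        using nz degree_poly_of[of "p(n := w)" n] by (auto simp: coeff_poly_of n_def)
      then obtain b A where b: "b \<noteq> 0" "?P = [:1, -b:] * A"
        using split_linear_factor by metis
      have "poly ?P (1 / b) = 0"
        using b by simp
      then have "(\<Sum>k<n. p k * (1 / b) ^ k) + w * (1 / b) ^ n = 0"
        by (simp add: poly_poly_of)
      then have "b ^ n * ((\<Sum>k<n. p k * (1 / b) ^ k) + w * (1 / b) ^ n) = 0"
        by simp
      moreover have "b ^ n * (\<Sum>k<n. p k * (1 / b) ^ k) = tail_sum b n p"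
        unfolding tail_sum_def sum_distrib_left
        by (intro sum.cong) (use b in \<open>auto simp: power_diff field_simps\<close>)
      moreover have "b ^ n * (w * (1 / b) ^ n) = w"
        using b by (simp add: field_simps)
      ultimately have "w = - tail_sum b n p"
        by (simp add: distrib_left eq_neg_iff_add_eq_0 add.commute)
      then show ?thesis
        using w by blast
    qed
    then have "{w. p(n := w) \<in> nongeneric n} \<subseteq> (\<lambda>b. - tail_sum b n p) ` ?T"
      by blast
    moreover have "negligible ((\<lambda>b. - tail_sum b n p) ` ?T)"
    proof (rule negligible_differentiable_image_negligible[OF order_refl T])
      have "(\<lambda>b. - tail_sum b n p) differentiable (at b within ?T)" for b
        unfolding tail_sum_def by (intro derivative_intros) auto
      then show "(\<lambda>b. - tail_sum b n p) differentiable_on ?T"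
        by (simp add: differentiable_on_def)
    qed
    ultimately have "negligible {w. p(n := w) \<in> nongeneric n}"
      by (rule negligible_subset[rotated])
    then show ?case
      using AE_lborel_notin_iff[of "{w. p(n := w) \<in> nongeneric n}"] by simp
  qed
  then have "nongeneric n \<in> null_sets (PiM {..<Suc n} (\<lambda>_. lborel))"
    by (intro null_sets_PiM_Suc X)
  then show ?case by (simp add: n_def)
qed

section \<open>From polynomials back to signals\<close>

definition poly_of_signal :: "nat \<Rightarrow> signal \<Rightarrow> complex poly" where
  "poly_of_signal N x = poly_of N (\<lambda>i. x (int i))"

lemma fourier_transform_eq_poly:
  assumes "has_support N x"
  shows "fourier_transform x \<omega> = poly (poly_of_signal N x) (cis (- \<omega>))"
proof -
  have "fourier_transform x \<omega> = (\<Sum>\<^sub>\<infinity>n\<in>int ` {..<N}. x n * exp (- \<i> * of_real \<omega> * of_int n))"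
    unfolding fourier_transform_def
  proof (rule infsum_cong_neutral)
    fix n assume "n \<in> UNIV - int ` {..<N}"
    then have "n \<notin> {0..int N - 1}"
      using image_iff zero_le_imp_eq_int by fastforce
    then show "x n * exp (- \<i> * of_real \<omega> * of_int n) = 0"
      using assms by (simp add: has_support_def)
  qed auto
  also have "\<dots> = (\<Sum>i<N. x (int i) * exp (- \<i> * of_real \<omega> * of_nat i))"
    by (simp add: sum.reindex)
  also have "\<dots> = (\<Sum>i<N. x (int i) * cis (- \<omega>) ^ i)"
    by (intro sum.cong refl arg_cong2[of _ _ _ _ "(*)"])
      (simp add: cis_conv_exp exp_of_nat_mult[symmetric] mult_ac)
  finally show ?thesis
    by (simp add: poly_of_signal_def poly_poly_of)
qed

lemma zcoeff_poly_of_signal: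
  assumes "has_support N x"
  shows "zcoeff (poly_of_signal N x) k = x k"
  using assms by (auto simp: zcoeff_def poly_of_signal_def coeff_poly_of has_support_def)

lemma degree_poly_of_signal:
  assumes "has_support (Suc d) x"
  shows "degree (poly_of_signal (Suc d) x) = d" "coeff (poly_of_signal (Suc d) x) 0 \<noteq> 0"
  using assms degree_poly_of[of "\<lambda>i. x (int i)" d]
  by (auto simp: poly_of_signal_def coeff_poly_of has_support_def)

lemma cis_Arg_unimodular: "norm z = 1 \<Longrightarrow> cis (Arg z) = z"
  using cis_Arg[of z] by (cases "z = 0") (auto simp: sgn_eq)

lemma cospectral_poly_of_signal:
  assumes x: "has_support (Suc d) x" and y: "has_support (Suc d) y"
    and eq: "fourier_intensity y = fourier_intensity x"
  shows "cospectral (poly_of_signal (Suc d) x) (poly_of_signal (Suc d) y)"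
proof -
  have "norm (poly (poly_of_signal (Suc d) x) z) = norm (poly (poly_of_signal (Suc d) y) z)"
    if "norm z = 1" for z
  proof -
    have "norm (fourier_transform x (- Arg z)) = norm (fourier_transform y (- Arg z))"
      using fun_cong[OF eq, of "- Arg z"] by (simp add: fourier_intensity_def)
    then show ?thesis
      using cis_Arg_unimodular[OF that]
      by (simp add: fourier_transform_eq_poly[OF x] fourier_transform_eq_poly[OF y])
  qed
  then show ?thesis
    using degree_poly_of_signal[OF x] degree_poly_of_signal[OF y] by (simp add: cospectral_def)
qed

text \<open>
  Genericity is used with \<open>k = m\<close>, where the reflected alternative survives only for
  the central index.
\<close>

lemma generic_recoverable:
  assumes x: "has_support (Suc d) x" and gen: "generic (poly_of_signal (Suc d) x)"
    and y: "has_support (Suc d) y" "fourier_intensity y = fourier_intensity x"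
    and m: "0 \<le> m" "m \<le> int d" "norm (y m) = norm (x m)"
  shows "(\<exists>\<alpha>. y = rotation \<alpha> x) \<or>
    2 * m = int d \<and> (\<exists>\<alpha>. y = rotation \<alpha> (conj_reflection (Suc d) x))"
proof -
  let ?P = "poly_of_signal (Suc d) x" and ?Q = "poly_of_signal (Suc d) y"
  have PQ: "cospectral ?P ?Q"
    by (rule cospectral_poly_of_signal[OF x y])
  have P: "degree ?P = d" "coeff ?P 0 \<noteq> 0" and Q: "degree ?Q = d" "coeff ?Q 0 \<noteq> 0"
    using degree_poly_of_signal x y by blast+
  have unimodular: "\<exists>\<alpha>. u = exp (\<i> * of_real \<alpha>)" if "norm u = 1" for u
    using cis_Arg_unimodular[OF that] by (intro exI[of _ "Arg u"]) (simp add: cis_conv_exp)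
  have "(\<exists>u. ?Q = smult u ?P) \<or> (\<exists>u. conj_reverse ?Q = smult u ?P) \<and> m = int d - m"
    using genericD[OF gen PQ, of m m] m P
    by (simp add: zcoeff_poly_of_signal x y)
  then show ?thesis
  proof (elim disjE conjE exE)
    fix u assume u: "?Q = smult u ?P"
    then have "norm u = 1"
      using PQ cospectral_smult_unimodular by metis
    moreover have "y = (\<lambda>n. u * x n)"
      using zcoeff_poly_of_signal[OF x] zcoeff_poly_of_signal[OF y(1)] u
      by (metis zcoeff_smult)
    ultimately show ?thesis
      using unimodular by (fastforce simp: rotation_def)
  next
    fix u assume u: "conj_reverse ?Q = smult u ?P" and md: "m = int d - m"
    have "norm u = 1"
      using cospectral_conj_reverse[OF PQ] cospectral_smult_unimodular u by metis
    then obtain \<alpha> where \<alpha>: "cnj u = exp (\<i> * of_real \<alpha>)"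
      using unimodular[of "cnj u"] by auto
    have Q_eq: "?Q = smult (cnj u) (conj_reverse ?P)"
      using u conj_reverse_conj_reverse[OF Q(2)] conj_reverse_smult by metis
    have "y k = cnj u * cnj (x (int d - k))" for k
    proof -
      have "zcoeff (conj_reverse ?P) k = cnj (zcoeff ?P (int d - k))"
        using P by (auto simp: zcoeff_def coeff_conj_reverse nat_diff_distrib coeff_eq_0)
      then show ?thesis
        using zcoeff_poly_of_signal[OF x] zcoeff_poly_of_signal[OF y(1)] Q_eq
        by (metis zcoeff_smult)
    qed
    then have "y = rotation \<alpha> (conj_reflection (Suc d) x)"
      by (simp add: rotation_def conj_reflection_def \<alpha> fun_eq_iff)
    then show ?thesis
      using md by auto
  qed
qed

lemma complexify_vector_of_signal:
  "complexify N (vector_of_signal N x) = (\<lambda>i\<in>{..<N}. x (int i))"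
  by (auto simp: complexify_def vector_of_signal_def fun_eq_iff complex_eq_iff)

text \<open>
  The exceptional signals need not form a measurable set; it is enough that they lie in the null set
  of nongeneric vectors, since the measure is complete.
\<close>

lemma almost_every_signal_generic:
  assumes P: "\<And>x. has_support (Suc d) x \<Longrightarrow> generic (poly_of_signal (Suc d) x) \<Longrightarrow> P x"
  shows "almost_every_signal (Suc d) P"
proof -
  let ?Z = "complexify (Suc d) -` nongeneric d \<inter> space (PiM {..<2 * Suc d} (\<lambda>_. lborel))"
  have "vector_of_signal (Suc d) ` {x. has_support (Suc d) x \<and> \<not> P x} \<subseteq> ?Z"
  proof (intro image_subsetI)
    fix x assume "x \<in> {x. has_support (Suc d) x \<and> \<not> P x}"
    then have x: "has_support (Suc d) x" "\<not> generic (poly_of_signal (Suc d) x)"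
      using P by auto
    have "poly_of (Suc d) (\<lambda>i\<in>{..<Suc d}. x (int i)) = poly_of_signal (Suc d) x"
      by (simp add: poly_of_def poly_of_signal_def)
    then have "(\<lambda>i\<in>{..<Suc d}. x (int i)) \<in> nongeneric d"
      using x by (simp add: nongeneric_def has_support_def space_PiM)
    moreover have "vector_of_signal (Suc d) x \<in> space (PiM {..<2 * Suc d} (\<lambda>_. lborel))"
      unfolding vector_of_signal_def space_PiM by (rule restrict_PiE_iff[THEN iffD2]) simp
    ultimately show "vector_of_signal (Suc d) x \<in> ?Z"
      using complexify_vector_of_signal[of "Suc d" x] by simp
  qed
  then show ?thesis
    unfolding almost_every_signal_def lebesgue_tuples_def
    by (rule null_sets_completion_subset)
      (intro null_sets_completionI null_sets_vimage_complexify null_nongeneric)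
qed

theorem theorem3p4:
  fixes N :: nat and l :: int
  assumes "N \<ge> 1" and "0 \<le> l" and "l \<le> int N - 1"
  shows "(real_of_int l \<noteq> (real N - 1) / 2 \<longrightarrow>
            almost_every_signal N (recoverable_up_to_rotations N (int N - 1 - l))) \<and>
         (real_of_int l = (real N - 1) / 2 \<longrightarrow>
            almost_every_signal N (recoverable_up_to_rotations_and_reflections N (int N - 1 - l)))"
proof -
  obtain d where N: "N = Suc d"
    using assms(1) by (cases N) auto
  define m where "m = int N - 1 - l"
  have m: "0 \<le> m" "m \<le> int d"
    using assms by (auto simp: m_def N)
  have mid: "2 * m = int d \<longleftrightarrow> real_of_int l = (real N - 1) / 2"
  proof -
    have "real_of_int l = (real N - 1) / 2 \<longleftrightarrow> real_of_int (2 * l) = real_of_int (int d)"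
      by (auto simp: N)
    then show ?thesis
      unfolding of_int_eq_iff by (auto simp: m_def N)
  qed
  show ?thesis
    unfolding m_def[symmetric]
  proof (intro conjI impI)
    assume "real_of_int l \<noteq> (real N - 1) / 2"
    then show "almost_every_signal N (recoverable_up_to_rotations N m)"
      unfolding N recoverable_up_to_rotations_def
      using generic_recoverable[of d _ _ m] m mid by (intro almost_every_signal_generic) (metis N)
  next
    show "almost_every_signal N (recoverable_up_to_rotations_and_reflections N m)"
      unfolding N recoverable_up_to_rotations_and_reflections_def
      using generic_recoverable[of d _ _ m] m by (intro almost_every_signal_generic) metis
  qed
qed

end
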